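(* Let $T=(T_1,\dots,T_d)$ be a pure contractive $d$-tuple of operators (not necessarily commuting) on an infinite dimensional Hilbert space $\mathcal{H}$ with $\Delta_T=1$. Then the following are equivalent: (i) $T$ is maximal. (ii) There is no non-zero polynomial $P$ in $d$ non-commuting variables such that $P(T)|_{\mathcal{D}_1}=0$. (iii) $T\cong (P_{\mathcal{Q}}S_1|_{\mathcal{Q}},\dots,P_{\mathcal{Q}}S_d|_{\mathcal{Q}})$, where $\mathcal{Q}$ is a co-invariant subspace for the creation tuple $(S_1,\dots,S_d)$ on $\mathcal{F}^2_d$ such that $\dim[\mathrm{ran}\, P_{\mathcal{Q}}|_{\Gamma_{n]}}]=1+d+\dots+d^{n}$ for all $n\in\mathbb{N}$. (iv) For every $n\in\mathbb{N}$, $(\Gamma_{n]}\otimes\mathcal{D}_1)\cap\ker K(T)^*=\{0\}$.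
   Context: A $d$-tuple $T=(T_1,\dots,T_d)$ of bounded linear operators on a Hilbert space $\mathcal{H}$ is a contractive tuple if $\sum_{i=1}^d T_iT_i^*\le I_{\mathcal{H}}$. Define $\Psi_T:B(\mathcal{H})\to B(\mathcal{H})$ by $\Psi_T(X)=\sum_{i=1}^d T_iXT_i^*$. $T$ is pure if $\Psi_T^n(I)\to 0$ in the strong operator topology as $n\to\infty$. The defect operator is $D_T:=(I-\sum_{i=1}^dT_iT_i^* )^{1/2}$. For $n\in\mathbb{N}=\{1,2,\dots\}$ the $n$-th defect space is $\mathcal{D}_n:=\overline{\mathrm{ran}}(I-\Psi_T^n(I))$, and the $n$-th defect index is $\Delta_T^n:=\dim\mathcal{D}_n$ (the superscript is an index, not a power); $\Delta_T:=\Delta_T^1$. A contractive $d$-tuple $T$ with $\Delta_T<\infty$ on an infinite dimensional Hilbert space is maximal if $\Delta_T^n=(1+d+\dots+d^{n-1})\Delta_T$ for all $n\in\mathbb{N}$. For a polynomial $P$ in $d$ non-commuting variables (an element of the free algebra over $\mathbb{C}$), $P(T)$ is obtained by substituting $T_i$ for the $i$-th variable. Let $\Lambda=\{1,\dots,d\}$; for $k\ge1$ let $F(k,\Lambda)$ be the set of all functions $\{1,\dots,k\}\to\Lambda$, let $F(0,\Lambda)=\{0\}$, $F=\bigcup_{k\ge0}F(k,\Lambda)$ and $F_{n]}=\bigcup_{k=0}^nF(k,\Lambda)$. For $f\in F(k,\Lambda)$ with $k\ge 1$ write $T_f=T_{f(1)}T_{f(2)}\cdots T_{f(k)}$, and $T_0=I$.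 The full Fock space over $\mathbb{C}^d$ (orthonormal basis $e_1,\dots,e_d$) is $\mathcal{F}^2_d=\mathbb{C}\oplus\bigoplus_{m\ge1}(\mathbb{C}^d)^{\otimes m}$, with orthonormal basis $\{e_f:f\in F\}$, where $e_f=e_{f(1)}\otimes\cdots\otimes e_{f(k)}$ for $f\in F(k,\Lambda)$, $k\ge1$, and $e_0=\omega$ is the vacuum vector. $\Gamma_{n]}:=\mathrm{span}\{e_f:f\in F_{n]}\}$. The creation operators are $S_i:\mathcal{F}^2_d\to\mathcal{F}^2_d$, $\psi\mapsto e_i\otimes\psi$, $i=1,\dots,d$. A closed subspace $\mathcal{Q}$ is co-invariant for $(S_1,\dots,S_d)$ if $\mathcal{Q}^\perp$ is invariant under each $S_i$; $P_{\mathcal{Q}}$ is the orthogonal projection onto $\mathcal{Q}$. $\cong$ denotes simultaneous unitary equivalence of tuples. The Poisson kernel of $T$ is the operator $K(T):\mathcal{H}\to\mathcal{F}^2_d\otimes\mathcal{D}_1$, $h\mapsto\sum_{f\in F}e_f\otimes D_T(T_f)^*h$ (an isometry when $T$ is pure); its adjoint $K(T)^*:\mathcal{F}^2_d\otimes\mathcal{D}_1\to\mathcal{H}$ is the bounded operator determined by $e_f\otimes\xi\mapsto T_fD_T\xi$. *)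

theory Defs
  imports "HOL-Analysis.Analysis" "HOL-Library.Poly_Mapping" "HOL-Library.Extended_Nat"
begin

section \<open>Complex Hilbert spaces\<close>

text \<open>
  The complex inner product is conjugate-linear in its first argument. Its real part is the
  inner product of the underlying real space, so norm and topology are the library ones.
\<close>

class complex_inner = real_inner +
  fixes scaleC :: "complex \<Rightarrow> 'a \<Rightarrow> 'a" (infixr "*\<^sub>C" 75)
    and cinner :: "'a \<Rightarrow> 'a \<Rightarrow> complex"
  assumes scaleC_add_right: "c *\<^sub>C (x + y) = c *\<^sub>C x + c *\<^sub>C y"
    and scaleC_add_left: "(c + d) *\<^sub>C x = c *\<^sub>C x + d *\<^sub>C x"
    and scaleC_scaleC: "c *\<^sub>C d *\<^sub>C x = (c * d) *\<^sub>C x"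
    and scaleR_scaleC: "r *\<^sub>R x = complex_of_real r *\<^sub>C x"
    and cinner_commute: "cinner x y = cnj (cinner y x)"
    and cinner_add_left: "cinner (x + y) z = cinner x z + cinner y z"
    and cinner_scaleC_left: "cinner (c *\<^sub>C x) y = cnj c * cinner x y"
    and inner_eq_Re_cinner: "inner x y = Re (cinner x y)"

class chilbert_space = complex_inner + complete_space

global_interpretation complex_vector: vector_space "scaleC :: complex \<Rightarrow> 'a \<Rightarrow> 'a :: complex_inner"
  defines cspan = complex_vector.span
    and csubspace = complex_vector.subspace
    and cdependent = complex_vector.dependent
    and cdim = complex_vector.dim
    and cextend_basis = complex_vector.extend_basis
    and crepresentation = complex_vector.representation
proof unfold_locales
  fix x :: 'a
  show "1 *\<^sub>C x = x"
    using scaleR_scaleC[of 1 x] by simp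
qed (simp_all add: scaleC_add_right scaleC_add_left scaleC_scaleC)

lemma cinner_scaleC_right: "cinner x (c *\<^sub>C y) = c * cinner x (y :: 'a :: complex_inner)"
  by (metis cinner_commute cinner_scaleC_left complex_cnj_cnj complex_cnj_mult)

lemma norm_scaleC: "norm (c *\<^sub>C x) = cmod c * norm (x :: 'a :: complex_inner)"
proof -
  have "inner (c *\<^sub>C x) (c *\<^sub>C x) = Re (cnj c * c * cinner x x)"
    by (simp only: inner_eq_Re_cinner cinner_scaleC_left cinner_scaleC_right mult.assoc
        mult.left_commute)
  also have "cnj c * c = complex_of_real ((cmod c)\<^sup>2)"
    using complex_norm_square[of c] by (simp add: mult.commute)
  finally have "inner (c *\<^sub>C x) (c *\<^sub>C x) = (cmod c)\<^sup>2 * inner x x"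
    by (simp add: inner_eq_Re_cinner)
  thus ?thesis
    by (simp add: norm_eq_sqrt_inner real_sqrt_mult)
qed

lemma cmod_cinner_le: "cmod (cinner x y) \<le> norm x * norm (y :: 'a :: complex_inner)"
proof (cases "cinner x y = 0")
  case False
  define u where "u = cnj (sgn (cinner x y))"
  have "cmod u = 1"
    using False by (simp add: u_def norm_sgn)
  have "cnj (sgn z) * z = complex_of_real (cmod z)" for z
  proof (cases "z = 0")
    case False
    have "cnj (sgn z) * z = cnj z * z /\<^sub>R cmod z"
      by (simp add: sgn_div_norm)
    also have "cnj z * z = complex_of_real ((cmod z)\<^sup>2)"
      using complex_norm_square[of z] by (simp add: mult.commute)
    finally show ?thesis
      using False by (simp add: scaleR_conv_of_real power2_eq_square)
  qed simp
  hence "cmod (cinner x y) = Re (cinner x (u *\<^sub>C y))"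
    by (simp add: cinner_scaleC_right u_def)
  also have "\<dots> \<le> norm x * norm (u *\<^sub>C y)"
    using norm_cauchy_schwarz[of x "u *\<^sub>C y"] by (simp only: inner_eq_Re_cinner)
  finally show ?thesis
    using \<open>cmod u = 1\<close> by (simp add: norm_scaleC)
qed simp

instantiation complex :: chilbert_space
begin

definition scaleC_complex :: "complex \<Rightarrow> complex \<Rightarrow> complex"
  where "scaleC_complex c x = c * x"

definition cinner_complex :: "complex \<Rightarrow> complex \<Rightarrow> complex"
  where "cinner_complex x y = cnj x * y"

instance
  by standard (auto simp: scaleC_complex_def cinner_complex_def algebra_simps inner_complex_def
      scaleR_conv_of_real)

end

text \<open>
  Dimension in \<open>\<nat> \<union> {\<infinity>}\<close>; \<^const>\<open>cdim\<close> alone is \<open>0\<close> on infinite-dimensional subspaces.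
\<close>

definition cdimension :: "'a::complex_inner set \<Rightarrow> enat" where
  "cdimension V = (if \<exists>B. finite B \<and> V \<subseteq> cspan B then enat (cdim V) else \<infinity>)"

definition closed_csubspace :: "'a::complex_inner set \<Rightarrow> bool" where
  "closed_csubspace M \<longleftrightarrow> csubspace M \<and> closed M"

definition corthogonal :: "'a::complex_inner set \<Rightarrow> 'a set" where
  "corthogonal M = {x. \<forall>y\<in>M. cinner y x = 0}"

definition projection :: "'a::complex_inner set \<Rightarrow> 'a \<Rightarrow> 'a" where
  "projection M x = (THE y. y \<in> M \<and> x - y \<in> corthogonal M)"


section \<open>Operators\<close>

definition bounded_clinear :: "('a::complex_inner \<Rightarrow> 'b::complex_inner) \<Rightarrow> bool" where
  "bounded_clinear A \<longleftrightarrow> bounded_linear A \<and> (\<forall>c x. A (c *\<^sub>C x) = c *\<^sub>C A x)"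

definition cadj :: "('a::complex_inner \<Rightarrow> 'b::complex_inner) \<Rightarrow> 'b \<Rightarrow> 'a" where
  "cadj A = (THE B. \<forall>x y. cinner (A x) y = cinner x (B y))"

definition positive_op :: "('a::complex_inner \<Rightarrow> 'a) \<Rightarrow> bool" where
  "positive_op A \<longleftrightarrow>
     bounded_clinear A \<and> (\<forall>x. cinner x (A x) \<in> \<real> \<and> 0 \<le> Re (cinner x (A x)))"

definition sqrt_op :: "('a::complex_inner \<Rightarrow> 'a) \<Rightarrow> 'a \<Rightarrow> 'a" where
  "sqrt_op A = (THE B. positive_op B \<and> B \<circ> B = A)"

definition coinvariant :: "('d \<Rightarrow> 'a::complex_inner \<Rightarrow> 'a) \<Rightarrow> 'a set \<Rightarrow> bool" where
  "coinvariant S Q \<longleftrightarrow> closed_csubspace Q \<and> (\<forall>i. S i ` corthogonal Q \<subseteq> corthogonal Q)"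

text \<open>\<open>A i\<close> acts on the closed subspace \<open>M\<close> and \<open>B i\<close> on the closed subspace \<open>N\<close>.\<close>

definition unitarily_equivalent ::
  "'a::complex_inner set \<Rightarrow> ('d \<Rightarrow> 'a \<Rightarrow> 'a) \<Rightarrow> 'b::complex_inner set \<Rightarrow> ('d \<Rightarrow> 'b \<Rightarrow> 'b) \<Rightarrow> bool"
  where
  "unitarily_equivalent M A N B \<longleftrightarrow>
     (\<exists>U. (\<forall>x\<in>M. \<forall>y\<in>M. U (x + y) = U x + U y) \<and> (\<forall>c. \<forall>x\<in>M. U (c *\<^sub>C x) = c *\<^sub>C U x) \<and>
          (\<forall>x\<in>M. \<forall>y\<in>M. cinner (U x) (U y) = cinner x y) \<and> U ` M = N \<and>
          (\<forall>i. \<forall>x\<in>M. U (A i x) = B i (U x)))"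


section \<open>Square-summable families\<close>

typedef (overloaded) ('i, 'a::complex_inner) ell2 =
  "{f :: 'i \<Rightarrow> 'a. (\<lambda>i. (norm (f i))\<^sup>2) summable_on UNIV}"
  morphisms ell2_nth Abs_ell2
  by (rule exI[of _ "\<lambda>_. 0"]) simp

setup_lifting type_definition_ell2

lemma ell2_summable: "(\<lambda>i. (norm (ell2_nth x i))\<^sup>2) summable_on UNIV"
  using ell2_nth[of x] by simp

lemma square_summable_add:
  fixes f g :: "'i \<Rightarrow> 'a::real_normed_vector"
  assumes "(\<lambda>i. (norm (f i))\<^sup>2) summable_on A" and "(\<lambda>i. (norm (g i))\<^sup>2) summable_on A"
  shows "(\<lambda>i. (norm (f i + g i))\<^sup>2) summable_on A"
proof (rule summable_on_comparison_test)
  show "(\<lambda>i. 2 * (norm (f i))\<^sup>2 + 2 * (norm (g i))\<^sup>2) summable_on A"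
    by (intro summable_on_add summable_on_cmult_right assms)
  fix i
  have "(norm (f i + g i))\<^sup>2 \<le> (norm (f i) + norm (g i))\<^sup>2"
    by (intro power_mono norm_triangle_ineq norm_ge_zero)
  also have "\<dots> \<le> 2 * (norm (f i))\<^sup>2 + 2 * (norm (g i))\<^sup>2"
    using sum_squares_bound[of "norm (f i)" "norm (g i)"] by (simp add: power2_sum)
  finally show "(norm (f i + g i))\<^sup>2 \<le> 2 * (norm (f i))\<^sup>2 + 2 * (norm (g i))\<^sup>2" .
qed simp_all

instantiation ell2 :: (type, complex_inner) complex_inner
begin

lift_definition zero_ell2 :: "('a, 'b) ell2" is "\<lambda>_. 0" by simp

lift_definition plus_ell2 :: "('a, 'b) ell2 \<Rightarrow> ('a, 'b) ell2 \<Rightarrow> ('a, 'b) ell2"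
  is "\<lambda>f g i. f i + g i" by (rule square_summable_add)

lift_definition uminus_ell2 :: "('a, 'b) ell2 \<Rightarrow> ('a, 'b) ell2" is "\<lambda>f i. - f i" by simp

lift_definition minus_ell2 :: "('a, 'b) ell2 \<Rightarrow> ('a, 'b) ell2 \<Rightarrow> ('a, 'b) ell2"
  is "\<lambda>f g i. f i - g i"
  using square_summable_add[of _ UNIV "\<lambda>i. - _ i"] by fastforce

lift_definition scaleC_ell2 :: "complex \<Rightarrow> ('a, 'b) ell2 \<Rightarrow> ('a, 'b) ell2"
  is "\<lambda>c f i. c *\<^sub>C f i"
  by (simp add: norm_scaleC power_mult_distrib summable_on_cmult_right)

definition scaleR_ell2 :: "real \<Rightarrow> ('a, 'b) ell2 \<Rightarrow> ('a, 'b) ell2"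
  where "scaleR_ell2 r x = complex_of_real r *\<^sub>C x"

definition cinner_ell2 :: "('a, 'b) ell2 \<Rightarrow> ('a, 'b) ell2 \<Rightarrow> complex"
  where "cinner_ell2 x y = (\<Sum>\<^sub>\<infinity>i. cinner (ell2_nth x i) (ell2_nth y i))"

definition inner_ell2 :: "('a, 'b) ell2 \<Rightarrow> ('a, 'b) ell2 \<Rightarrow> real"
  where "inner_ell2 x y = Re (cinner x y)"

definition norm_ell2 :: "('a, 'b) ell2 \<Rightarrow> real"
  where "norm_ell2 x = sqrt (inner x x)"

definition dist_ell2 :: "('a, 'b) ell2 \<Rightarrow> ('a, 'b) ell2 \<Rightarrow> real"
  where "dist_ell2 x y = norm (x - y)"

definition sgn_ell2 :: "('a, 'b) ell2 \<Rightarrow> ('a, 'b) ell2"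
  where "sgn_ell2 x = inverse (norm x) *\<^sub>R x"

definition uniformity_ell2 :: "(('a, 'b) ell2 \<times> ('a, 'b) ell2) filter"
  where "uniformity_ell2 = (INF e\<in>{0<..}. principal {(x, y). dist x y < e})"

definition open_ell2 :: "('a, 'b) ell2 set \<Rightarrow> bool"
  where "open_ell2 U \<longleftrightarrow> (\<forall>x\<in>U. \<forall>\<^sub>F (x', y) in uniformity. x' = x \<longrightarrow> y \<in> U)"

lemma cinner_ell2_summable:
  "(\<lambda>i. cinner (ell2_nth x i) (ell2_nth y i :: 'b)) summable_on UNIV"
proof (rule abs_summable_summable[OF summable_on_comparison_test])
  show "(\<lambda>i. (norm (ell2_nth x i))\<^sup>2 + (norm (ell2_nth y i))\<^sup>2) summable_on UNIV"
    by (intro summable_on_add ell2_summable)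
  fix i
  have "cmod (cinner (ell2_nth x i) (ell2_nth y i)) \<le> norm (ell2_nth x i) * norm (ell2_nth y i)"
    by (rule cmod_cinner_le)
  also have "\<dots> \<le> (norm (ell2_nth x i))\<^sup>2 + (norm (ell2_nth y i))\<^sup>2"
    using sum_squares_bound[of "norm (ell2_nth x i)" "norm (ell2_nth y i)"]
      mult_nonneg_nonneg[OF norm_ge_zero norm_ge_zero, of "ell2_nth x i" "ell2_nth y i"]
    by linarith
  finally show "cmod (cinner (ell2_nth x i) (ell2_nth y i))
      \<le> (norm (ell2_nth x i))\<^sup>2 + (norm (ell2_nth y i))\<^sup>2" .
qed simp

lemma inner_ell2_self: "inner x x = (\<Sum>\<^sub>\<infinity>i. (norm (ell2_nth x i :: 'b))\<^sup>2)"
  by (simp add: inner_ell2_def cinner_ell2_def power2_norm_eq_inner inner_eq_Re_cinner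
      flip: infsum_Re[OF cinner_ell2_summable])

instance
proof
  fix x y z :: "('a, 'b) ell2" and c d :: complex and r s :: real
  show "x + y + z = x + (y + z)" "x + y = y + x" "0 + x = x" "- x + x = 0" "x - y = x + - y"
    by (transfer, simp add: algebra_simps)+
  show scC: "c *\<^sub>C (x + y) = c *\<^sub>C x + c *\<^sub>C y" "(c + d) *\<^sub>C x = c *\<^sub>C x + d *\<^sub>C x"
    "c *\<^sub>C d *\<^sub>C x = (c * d) *\<^sub>C x" for c d and x y :: "('a, 'b) ell2"
    by (transfer, simp add: scaleC_add_right scaleC_add_left scaleC_scaleC)+
  show "r *\<^sub>R x = complex_of_real r *\<^sub>C x"
    by (fact scaleR_ell2_def)
  show "r *\<^sub>R (x + y) = r *\<^sub>R x + r *\<^sub>R y" "(r + s) *\<^sub>R x = r *\<^sub>R x + s *\<^sub>R x"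
    "r *\<^sub>R s *\<^sub>R x = (r * s) *\<^sub>R x"
    by (simp_all add: scaleR_ell2_def scC)
  show "1 *\<^sub>R x = x"
    unfolding scaleR_ell2_def by transfer simp
  show com: "cinner x y = cnj (cinner y x)" for x y :: "('a, 'b) ell2"
    unfolding cinner_ell2_def infsum_cnj[symmetric] by (simp flip: cinner_commute)
  show add: "cinner (x + y) z = cinner x z + cinner y z"
    by (simp add: cinner_ell2_def plus_ell2.rep_eq cinner_add_left
        infsum_add[OF cinner_ell2_summable cinner_ell2_summable])
  show scl: "cinner (c *\<^sub>C x) y = cnj c * cinner x y" for c
    by (simp add: cinner_ell2_def scaleC_ell2.rep_eq cinner_scaleC_left infsum_cmult_right')
  show "inner x y = Re (cinner x y)"
    by (fact inner_ell2_def)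
  show "inner x y = inner y x"
    by (simp add: inner_ell2_def com[of x y])
  show "inner (x + y) z = inner x z + inner y z"
    by (simp add: inner_ell2_def add)
  show "inner (r *\<^sub>R x) y = r * inner x y"
    by (simp add: inner_ell2_def scaleR_ell2_def scl)
  show "0 \<le> inner x x"
    unfolding inner_ell2_self by (simp add: infsum_nonneg)
  show "inner x x = 0 \<longleftrightarrow> x = 0"
  proof
    assume "inner x x = 0"
    hence "ell2_nth x i = 0" for i
      using nonneg_infsum_le_0D[OF _ ell2_summable, of x i] by (simp add: inner_ell2_self)
    thus "x = 0"
      by (simp add: zero_ell2.rep_eq fun_eq_iff flip: ell2_nth_inject)
  qed (simp add: inner_ell2_self zero_ell2.rep_eq)
qed (simp_all add: norm_ell2_def dist_ell2_def sgn_ell2_def uniformity_ell2_def open_ell2_def)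

end

lemma norm_ell2_power2: "(norm x)\<^sup>2 = (\<Sum>\<^sub>\<infinity>i. (norm (ell2_nth x i))\<^sup>2)"
  by (simp add: power2_norm_eq_inner inner_ell2_self)

lemma sum_le_norm_ell2:
  assumes "finite F"
  shows "(\<Sum>i\<in>F. (norm (ell2_nth x i))\<^sup>2) \<le> (norm x)\<^sup>2"
  unfolding norm_ell2_power2
  by (rule finite_sum_le_infsum[OF ell2_summable assms]) simp_all

lemma norm_ell2_nth_le: "norm (ell2_nth x i) \<le> norm x"
  using sum_le_norm_ell2[of "{i}" x] by (simp add: power2_le_iff_abs_le)

instance ell2 :: (type, chilbert_space) chilbert_space
proof
  fix X :: "nat \<Rightarrow> ('a, 'b) ell2"
  assume X: "Cauchy X"
  have "Cauchy (\<lambda>n. ell2_nth (X n) i)" for i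
  proof (rule metric_CauchyI)
    fix e :: real
    assume "e > 0"
    then obtain M where M: "\<forall>m\<ge>M. \<forall>n\<ge>M. dist (X m) (X n) < e"
      using X unfolding Cauchy_def by metis
    have "dist (ell2_nth (X m) i) (ell2_nth (X n) i) \<le> dist (X m) (X n)" for m n
      using norm_ell2_nth_le[of "X m - X n" i] by (simp add: dist_norm minus_ell2.rep_eq)
    thus "\<exists>M. \<forall>m\<ge>M. \<forall>n\<ge>M. dist (ell2_nth (X m) i) (ell2_nth (X n) i) < e"
      using M by (meson le_less_trans)
  qed
  hence "\<exists>l. (\<lambda>n. ell2_nth (X n) i) \<longlonglongrightarrow> l" for i
    using Cauchy_convergent convergent_def by blast
  then obtain L where L: "\<And>i. (\<lambda>n. ell2_nth (X n) i) \<longlonglongrightarrow> L i"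
    by metis
  have tail: "\<exists>M. \<forall>n\<ge>M. \<forall>F. finite F \<longrightarrow> (\<Sum>i\<in>F. (norm (ell2_nth (X n) i - L i))\<^sup>2) \<le> e\<^sup>2"
    if "e > 0" for e
  proof -
    obtain M where M: "\<And>m n. m \<ge> M \<Longrightarrow> n \<ge> M \<Longrightarrow> norm (X m - X n) < e"
      using X \<open>e > 0\<close> unfolding Cauchy_def dist_norm by metis
    have "(\<Sum>i\<in>F. (norm (ell2_nth (X n) i - L i))\<^sup>2) \<le> e\<^sup>2" if "n \<ge> M" "finite F" for n F
    proof (rule tendsto_upperbound)
      show "(\<lambda>m. \<Sum>i\<in>F. (norm (ell2_nth (X n) i - ell2_nth (X m) i))\<^sup>2)
          \<longlonglongrightarrow> (\<Sum>i\<in>F. (norm (ell2_nth (X n) i - L i))\<^sup>2)"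
        by (intro tendsto_intros L)
      have "(\<Sum>i\<in>F. (norm (ell2_nth (X n) i - ell2_nth (X m) i))\<^sup>2) \<le> e\<^sup>2" if "m \<ge> M" for m
      proof -
        have "(\<Sum>i\<in>F. (norm (ell2_nth (X n) i - ell2_nth (X m) i))\<^sup>2) \<le> (norm (X n - X m))\<^sup>2"
          using sum_le_norm_ell2[OF \<open>finite F\<close>, of "X n - X m"] by (simp add: minus_ell2.rep_eq)
        also have "\<dots> \<le> e\<^sup>2"
          using M[OF \<open>n \<ge> M\<close> that] by (intro power_mono) auto
        finally show ?thesis .
      qed
      thus "\<forall>\<^sub>F m in sequentially. (\<Sum>i\<in>F. (norm (ell2_nth (X n) i - ell2_nth (X m) i))\<^sup>2) \<le> e\<^sup>2"
        unfolding eventually_sequentially by blast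
    qed simp
    thus ?thesis by blast
  qed
  have summ: "(\<lambda>i. (norm (ell2_nth (X n) i - L i))\<^sup>2) summable_on UNIV \<and>
      (\<Sum>\<^sub>\<infinity>i. (norm (ell2_nth (X n) i - L i))\<^sup>2) \<le> e\<^sup>2"
    if "\<forall>F. finite F \<longrightarrow> (\<Sum>i\<in>F. (norm (ell2_nth (X n) i - L i))\<^sup>2) \<le> e\<^sup>2" for n e
  proof -
    have s: "(\<lambda>i. (norm (ell2_nth (X n) i - L i))\<^sup>2) summable_on UNIV"
      by (rule nonneg_bdd_above_summable_on) (use that in \<open>auto intro!: bdd_aboveI2\<close>)
    moreover have "(\<Sum>\<^sub>\<infinity>i. (norm (ell2_nth (X n) i - L i))\<^sup>2) \<le> e\<^sup>2"
      by (rule infsum_le_finite_sums[OF s]) (use that in auto)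
    ultimately show ?thesis by blast
  qed
  obtain M where "\<forall>F. finite F \<longrightarrow> (\<Sum>i\<in>F. (norm (ell2_nth (X M) i - L i))\<^sup>2) \<le> 1\<^sup>2"
    using tail[of 1] by auto
  hence "(\<lambda>i. (norm (ell2_nth (X M) i - L i))\<^sup>2) summable_on UNIV"
    using summ by blast
  hence "(\<lambda>i. (norm (ell2_nth (X M) i + - (ell2_nth (X M) i - L i)))\<^sup>2) summable_on UNIV"
    by (intro square_summable_add ell2_summable) (simp add: norm_minus_commute)
  hence "(\<lambda>i. (norm (L i))\<^sup>2) summable_on UNIV"
    by simp
  then obtain l where l: "ell2_nth l = L"
    by (metis Abs_ell2_inverse mem_Collect_eq)
  have "X \<longlonglongrightarrow> l"
  proof (rule metric_LIMSEQ_I)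
    fix e :: real
    assume "e > 0"
    then obtain M where
      M: "\<forall>n\<ge>M. \<forall>F. finite F \<longrightarrow> (\<Sum>i\<in>F. (norm (ell2_nth (X n) i - L i))\<^sup>2) \<le> (e / 2)\<^sup>2"
      using tail[of "e / 2"] by auto
    have "dist (X n) l < e" if "n \<ge> M" for n
    proof -
      have "(norm (X n - l))\<^sup>2 \<le> (e / 2)\<^sup>2"
        unfolding norm_ell2_power2 minus_ell2.rep_eq l using summ M that by blast
      hence "norm (X n - l) \<le> e / 2"
        using \<open>e > 0\<close> by (simp add: power2_le_iff_abs_le)
      thus ?thesis
        using \<open>e > 0\<close> by (simp add: dist_norm)
    qed
    thus "\<exists>M. \<forall>n\<ge>M. dist (X n) l < e" by blast
  qed
  thus "convergent X"
    by (auto simp: convergent_def)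
qed


section \<open>The full Fock space\<close>

text \<open>
  The variables are indexed by a finite type \<open>'d\<close> with \<open>d = CARD('d)\<close>, and the words in them are
  lists over \<open>'d\<close>, the vacuum vector belonging to the empty list. The full Fock space is the space
  of coordinate families with respect to its orthonormal basis of words. For a Hilbert space \<open>'h\<close>,
  the Hilbert tensor product of the Fock space with \<open>'h\<close> is \<open>('d list, 'h) ell2\<close>.
\<close>

type_synonym 'd fock = "('d list, complex) ell2"

lift_definition basis_vec :: "'i \<Rightarrow> ('i, complex) ell2" is "\<lambda>i j. if j = i then 1 else 0"
  by (rule finite_nonzero_values_imp_summable_on) simp

lift_definition creation :: "'d \<Rightarrow> 'd fock \<Rightarrow> 'd fock" is
  "\<lambda>i \<psi> w. case w of [] \<Rightarrow> 0 | j # v \<Rightarrow> if j = i then \<psi> v else 0"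
proof -
  fix i :: 'd and \<psi> :: "'d list \<Rightarrow> complex"
  let ?g = "\<lambda>w. case w of [] \<Rightarrow> 0 | j # v \<Rightarrow> if j = i then \<psi> v else 0"
  assume "(\<lambda>w. (cmod (\<psi> w))\<^sup>2) summable_on UNIV"
  hence "(\<lambda>w. (cmod (?g w))\<^sup>2) summable_on range (Cons i)"
    by (subst summable_on_reindex) (auto simp: o_def inj_on_def)
  thus "(\<lambda>w. (cmod (?g w))\<^sup>2) summable_on UNIV"
    by (rule summable_on_cong_neutral[THEN iffD1, rotated -1]) (auto split: list.splits if_splits)
qed

lemma creation_basis_vec: "creation i (basis_vec w) = basis_vec (i # w)"
  by transfer (auto simp: fun_eq_iff split: list.splits)

lift_definition tensor :: "('i, complex) ell2 \<Rightarrow> 'a::complex_inner \<Rightarrow> ('i, 'a) ell2" (infixl "\<otimes>\<^sub>h" 70)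
  is "\<lambda>\<psi> \<xi> i. \<psi> i *\<^sub>C \<xi>"
  by (simp add: norm_scaleC power_mult_distrib summable_on_cmult_left)

lemma cinner_tensor: "cinner (\<psi> \<otimes>\<^sub>h \<xi>) (\<phi> \<otimes>\<^sub>h \<eta>) = cinner \<psi> \<phi> * cinner \<xi> \<eta>"
  by (simp add: cinner_ell2_def tensor.rep_eq cinner_scaleC_left cinner_scaleC_right
      cinner_complex_def mult.assoc mult.left_commute flip: infsum_cmult_left')

definition tensor_space ::
  "('i, complex) ell2 set \<Rightarrow> 'a::complex_inner set \<Rightarrow> ('i, 'a) ell2 set" where
  "tensor_space M N = closure (cspan {\<psi> \<otimes>\<^sub>h \<xi> | \<psi> \<xi>. \<psi> \<in> M \<and> \<xi> \<in> N})"

definition fock_upto :: "nat \<Rightarrow> 'd fock set" where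
  "fock_upto n = cspan {basis_vec w | w. length w \<le> n}"


section \<open>Contractive tuples\<close>

definition Psi ::
  "('d::finite \<Rightarrow> 'h::complex_inner \<Rightarrow> 'h) \<Rightarrow> ('h \<Rightarrow> 'h) \<Rightarrow> 'h \<Rightarrow> 'h" where
  "Psi T X = (\<lambda>h. \<Sum>i\<in>UNIV. T i (X (cadj (T i) h)))"

definition defect_op :: "('d::finite \<Rightarrow> 'h::complex_inner \<Rightarrow> 'h) \<Rightarrow> nat \<Rightarrow> 'h \<Rightarrow> 'h" where
  "defect_op T n = (\<lambda>h. h - (Psi T ^^ n) id h)"

definition contractive_tuple :: "('d::finite \<Rightarrow> 'h::complex_inner \<Rightarrow> 'h) \<Rightarrow> bool" where
  "contractive_tuple T \<longleftrightarrow>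
     (\<forall>i. bounded_clinear (T i)) \<and> positive_op (\<lambda>h. h - (\<Sum>i\<in>UNIV. T i (cadj (T i) h)))"

definition pure_tuple :: "('d::finite \<Rightarrow> 'h::complex_inner \<Rightarrow> 'h) \<Rightarrow> bool" where
  "pure_tuple T \<longleftrightarrow> (\<forall>h. (\<lambda>n. (Psi T ^^ n) id h) \<longlonglongrightarrow> 0)"

definition defect_sqrt :: "('d::finite \<Rightarrow> 'h::complex_inner \<Rightarrow> 'h) \<Rightarrow> 'h \<Rightarrow> 'h" where
  "defect_sqrt T = sqrt_op (\<lambda>h. h - (\<Sum>i\<in>UNIV. T i (cadj (T i) h)))"

definition defect_space :: "('d::finite \<Rightarrow> 'h::complex_inner \<Rightarrow> 'h) \<Rightarrow> nat \<Rightarrow> 'h set" where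
  "defect_space T n = closure (range (defect_op T n))"

definition defect_index :: "('d::finite \<Rightarrow> 'h::complex_inner \<Rightarrow> 'h) \<Rightarrow> nat \<Rightarrow> enat" where
  "defect_index T n = cdimension (defect_space T n)"

definition maximal_tuple :: "('d::finite \<Rightarrow> 'h::complex_inner \<Rightarrow> 'h) \<Rightarrow> bool" where
  "maximal_tuple T \<longleftrightarrow>
     contractive_tuple T \<and> defect_index T 1 < \<infinity> \<and> cdimension (UNIV :: 'h set) = \<infinity> \<and>
     (\<forall>n\<ge>1. defect_index T n = enat (\<Sum>k<n. CARD('d) ^ k) * defect_index T 1)"

primrec word_op :: "('d \<Rightarrow> 'h \<Rightarrow> 'h) \<Rightarrow> 'd list \<Rightarrow> 'h \<Rightarrow> 'h" where
  "word_op T [] = id"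
| "word_op T (i # w) = T i \<circ> word_op T w"

text \<open>
  An element of the free algebra is a finitely supported family of coefficients of words.
\<close>

definition nc_eval ::
  "('d list \<Rightarrow>\<^sub>0 complex) \<Rightarrow> ('d \<Rightarrow> 'h::complex_inner \<Rightarrow> 'h) \<Rightarrow> 'h \<Rightarrow> 'h" where
  "nc_eval P T = (\<lambda>h. \<Sum>w\<in>Poly_Mapping.keys P. Poly_Mapping.lookup P w *\<^sub>C word_op T w h)"

definition poisson_kernel ::
  "('d::finite \<Rightarrow> 'h::complex_inner \<Rightarrow> 'h) \<Rightarrow> 'h \<Rightarrow> ('d list, 'h) ell2" where
  "poisson_kernel T h = (\<Sum>\<^sub>\<infinity>w. basis_vec w \<otimes>\<^sub>h defect_sqrt T (cadj (word_op T w) h))"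

text \<open>
  The Poisson kernel takes values in the closed subspace \<open>tensor_space UNIV (defect_space T 1)\<close>.
  Its adjoint with respect to that codomain is the restriction of \<open>cadj (poisson_kernel T)\<close> to
  the subspace.
\<close>

definition poisson_adj_kernel ::
  "('d::finite \<Rightarrow> 'h::complex_inner \<Rightarrow> 'h) \<Rightarrow> ('d list, 'h) ell2 set" where
  "poisson_adj_kernel T =
     {\<phi> \<in> tensor_space UNIV (defect_space T 1). cadj (poisson_kernel T) \<phi> = 0}"

end

theory Submission
  imports Defs
begin

text \<open>
  Since \<open>\<Delta>\<^sub>T = 1\<close>, the defect operator has the form \<open>h \<mapsto> \<langle>g, h\<rangle> g\<close>. Iterating,
  \<open>I - \<Psi>\<^sup>n(I)\<close> is the frame operator of the vectors \<open>T\<^sub>w g\<close> with \<open>w\<close> of length less than \<open>n\<close>,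
  so the \<open>n\<close>-th defect space is the span of these vectors and \<open>T\<close> is maximal iff the family
  \<open>(T\<^sub>w g)\<close>, over all words \<open>w\<close>, is linearly independent. Condition (ii) says the same thing directly, and so
  does (iv), because \<open>K(T)\<^sup>*\<close> maps \<open>e\<^sub>w \<otimes> g\<close> to a multiple of \<open>T\<^sub>w g\<close>. For (iii), purity makes
  \<open>h \<mapsto> (\<langle>T\<^sub>w g, h\<rangle>)\<^sub>w\<close> an isometry onto a co-invariant subspace \<open>\<Q>\<close> of the Fock space, under
  which \<open>T\<^sub>w g\<close> corresponds to the projection of \<open>e\<^sub>w\<close> onto \<open>\<Q>\<close>; conversely, in any such model the
  projected vacuum plays the role of \<open>g\<close>.
\<close>

subsection \<open>Inner products\<close>

lemma cinner_add_right: "cinner x (y + z) = cinner x y + cinner x (z :: 'a :: complex_inner)"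
  by (metis cinner_add_left cinner_commute complex_cnj_add)

lemma cinner_scaleR_left: "cinner (r *\<^sub>R x) y = r *\<^sub>R cinner x (y :: 'a :: complex_inner)"
  by (simp add: scaleR_scaleC[of r x] cinner_scaleC_left scaleR_conv_of_real)

lemma cinner_scaleR_right: "cinner x (r *\<^sub>R y) = r *\<^sub>R cinner x (y :: 'a :: complex_inner)"
  by (simp add: scaleR_scaleC[of r y] cinner_scaleC_right scaleR_conv_of_real)

text \<open>Sesquilinear over the complex numbers, the inner product is bilinear over the reals;
  this makes the limit, difference and sum rules of \<open>bounded_bilinear\<close>
  available.\<close>

lemma bounded_bilinear_cinner: "bounded_bilinear (cinner :: 'a::complex_inner \<Rightarrow> 'a \<Rightarrow> complex)"
proof
  show "\<exists>K. \<forall>a b :: 'a. norm (cinner a b) \<le> norm a * norm b * K"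
    by (rule exI[of _ 1]) (simp add: cmod_cinner_le)
qed (simp_all add: cinner_add_left cinner_add_right cinner_scaleR_left cinner_scaleR_right)

interpretation cinner: bounded_bilinear "cinner :: 'a::complex_inner \<Rightarrow> 'a \<Rightarrow> complex"
  by (rule bounded_bilinear_cinner)

lemma cinner_self: "cinner x x = complex_of_real ((norm x)\<^sup>2)"
  by (metis cinner_commute complex_cnj_cancel_iff complex_is_Real_iff inner_eq_Re_cinner of_real_Re
      power2_norm_eq_inner Reals_cnj_iff)

lemma cinner_eq_zero_iff [simp]: "cinner x x = 0 \<longleftrightarrow> x = 0"
  by (simp add: cinner_self)

lemma cinner_ext: "(\<And>z. cinner z x = cinner z y) \<Longrightarrow> x = y"
  using cinner_eq_zero_iff[of "x - y"] by (simp add: cinner.diff_right)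

lemma bounded_bilinear_scaleC: "bounded_bilinear (scaleC :: complex \<Rightarrow> 'a::complex_inner \<Rightarrow> 'a)"
proof
  show "\<exists>K. \<forall>a (b :: 'a). norm (a *\<^sub>C b) \<le> norm a * norm b * K"
    by (rule exI[of _ 1]) (simp add: norm_scaleC)
qed (simp_all add: scaleC_add_left scaleC_add_right scaleR_scaleC scaleC_scaleC mult.commute
      scaleC_complex_def)

interpretation scaleC: bounded_bilinear "scaleC :: complex \<Rightarrow> 'a::complex_inner \<Rightarrow> 'a"
  by (rule bounded_bilinear_scaleC)

lemma csubspace_scaleR: "csubspace M \<Longrightarrow> x \<in> M \<Longrightarrow> r *\<^sub>R x \<in> M"
  by (simp add: scaleR_scaleC complex_vector.subspace_scale)

lemma csubspace_corthogonal: "csubspace (corthogonal M)"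
  by (auto simp: complex_vector.subspace_def corthogonal_def cinner_add_right cinner_scaleC_right
      cinner.zero_right)

lemma corthogonal_Int: "x \<in> M \<Longrightarrow> x \<in> corthogonal M \<Longrightarrow> x = 0"
  by (auto simp: corthogonal_def)

subsection \<open>Orthogonal projections\<close>

text \<open>Solved for the difference and written with the midpoint, the form that shows a
  minimising sequence to be Cauchy.\<close>

lemma parallelogram:
  fixes a b :: "'a::real_inner"
  shows "(norm (a - b))\<^sup>2 = 2 * (norm a)\<^sup>2 + 2 * (norm b)\<^sup>2 - 4 * (norm ((1/2) *\<^sub>R (a + b)))\<^sup>2"
  by (simp add: power2_norm_eq_inner algebra_simps inner_commute)

text \<open>A sequence in \<open>M\<close> minimising the distance to \<open>x\<close> is Cauchy,
  because midpoints stay in \<open>M\<close>; its limit is a closest point.\<close>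

lemma closest_point_ex:
  fixes M :: "'a::chilbert_space set"
  assumes "closed_csubspace M"
  obtains y where "y \<in> M" "\<And>z. z \<in> M \<Longrightarrow> norm (x - y) \<le> norm (x - z)"
proof -
  have sub: "csubspace M" and cl: "closed M"
    using assms by (auto simp: closed_csubspace_def)
  define d where "d = Inf ((\<lambda>z. (norm (x - z))\<^sup>2) ` M)"
  have bdd: "bdd_below ((\<lambda>z. (norm (x - z))\<^sup>2) ` M)"
    by (rule bdd_belowI2[of _ 0]) simp
  have ne: "M \<noteq> {}"
    using complex_vector.subspace_0[OF sub] by auto
  have d_le: "d \<le> (norm (x - z))\<^sup>2" if "z \<in> M" for z
    unfolding d_def by (rule cINF_lower[OF bdd that])
  have "\<exists>z\<in>M. (norm (x - z))\<^sup>2 < d + 1 / real (Suc n)" for n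
  proof -
    have "d < d + 1 / real (Suc n)" by simp
    thus ?thesis
      unfolding d_def by (subst (asm) (1) cINF_less_iff[OF ne bdd])
  qed
  then obtain X where X: "\<And>n. X n \<in> M" "\<And>n. (norm (x - X n))\<^sup>2 < d + 1 / real (Suc n)"
    by metis
  \<comment> \<open>The midpoint has squared distance at least \<open>d\<close> from
    \<open>x\<close>, so in the parallelogram law the copies of \<open>d\<close> cancel and only the
    errors remain.\<close>
  have bound: "(norm (X m - X n))\<^sup>2 < 2 / real (Suc m) + 2 / real (Suc n)" for m n
  proof -
    have "(1/2) *\<^sub>R (X m + X n) \<in> M"
      by (intro csubspace_scaleR complex_vector.subspace_add sub X)
    hence "d \<le> (norm (x - (1/2) *\<^sub>R (X m + X n)))\<^sup>2"
      by (rule d_le)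
    moreover have "x - (1/2) *\<^sub>R (X m + X n) = (1/2) *\<^sub>R ((x - X n) + (x - X m))"
      by (simp add: algebra_simps flip: scaleR_2)
    ultimately have "d \<le> (norm ((1/2) *\<^sub>R ((x - X n) + (x - X m))))\<^sup>2"
      by simp
    moreover have "(norm (X m - X n))\<^sup>2 = 2 * (norm (x - X n))\<^sup>2 + 2 * (norm (x - X m))\<^sup>2
        - 4 * (norm ((1/2) *\<^sub>R ((x - X n) + (x - X m))))\<^sup>2"
      by (subst parallelogram[symmetric]) simp
    ultimately show ?thesis
      using X(2)[of m] X(2)[of n] by simp
  qed
  have "Cauchy X"
  proof (rule metric_CauchyI)
    fix e :: real assume "e > 0"
    then obtain N where N: "inverse (real (Suc N)) < e\<^sup>2 / 4"
      using reals_Archimedean[of "e\<^sup>2 / 4"] by auto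
    have "dist (X m) (X n) < e" if "m \<ge> N" "n \<ge> N" for m n
    proof -
      have "1 / real (Suc m) \<le> inverse (real (Suc N))" "1 / real (Suc n) \<le> inverse (real (Suc N))"
        using that by (auto simp: field_simps)
      hence "(norm (X m - X n))\<^sup>2 < e\<^sup>2"
        using bound[of m n] N by simp
      thus ?thesis
        using \<open>e > 0\<close> by (simp add: dist_norm power_less_imp_less_base)
    qed
    thus "\<exists>M. \<forall>m\<ge>M. \<forall>n\<ge>M. dist (X m) (X n) < e" by blast
  qed
  then obtain y where y: "X \<longlonglongrightarrow> y"
    using Cauchy_convergent convergent_def by blast
  have "y \<in> M"
    using closed_sequentially[OF cl] X(1) y by blast
  have "(norm (x - y))\<^sup>2 \<le> d + 0"
  proof (rule LIMSEQ_le)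
    show "(\<lambda>n. (norm (x - X n))\<^sup>2) \<longlonglongrightarrow> (norm (x - y))\<^sup>2"
      by (intro tendsto_intros y)
    show "(\<lambda>n. d + 1 / real (Suc n)) \<longlonglongrightarrow> d + 0"
      using LIMSEQ_inverse_real_of_nat by (intro tendsto_intros) (simp add: inverse_eq_divide)
  qed (intro exI allI impI less_imp_le X)
  hence le: "(norm (x - y))\<^sup>2 \<le> d"
    by simp
  have "norm (x - y) \<le> norm (x - z)" if "z \<in> M" for z
    by (rule power2_le_imp_le[OF order_trans[OF le d_le[OF that]] norm_ge_zero])
  with \<open>y \<in> M\<close> show ?thesis
    using that by blast
qed

lemma orthogonal_decomposition:
  fixes M :: "'a::chilbert_space set"
  assumes "closed_csubspace M"
  obtains y where "y \<in> M" "x - y \<in> corthogonal M"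
proof -
  obtain y where y: "y \<in> M" "\<And>z. z \<in> M \<Longrightarrow> norm (x - y) \<le> norm (x - z)"
    using closest_point_ex[OF assms] by blast
  have sub: "csubspace M"
    using assms by (simp add: closed_csubspace_def)
  have "cinner m (x - y) = 0" if "m \<in> M" for m
  proof (cases "m = 0")
    case False
    \<comment> \<open>The best choice of \<open>t\<close>: it removes the component of
      \<open>x - y\<close> along \<open>m\<close>, so a nonzero inner product would give a point of
      \<open>M\<close> closer to \<open>x\<close> than \<open>y\<close>.\<close>
    define t where "t = cinner m (x - y) / cinner m m"
    have "norm (x - y) \<le> norm (x - (y + t *\<^sub>C m))"
      by (intro y complex_vector.subspace_add complex_vector.subspace_scale sub that)
    also have "x - (y + t *\<^sub>C m) = (x - y) - t *\<^sub>C m"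
      by simp
    finally have "Re (cinner (x - y) (x - y)) \<le> Re (cinner ((x - y) - t *\<^sub>C m) ((x - y) - t *\<^sub>C m))"
      by (simp add: cinner_self)
    also have "cinner ((x - y) - t *\<^sub>C m) ((x - y) - t *\<^sub>C m)
        = cinner (x - y) (x - y) - t * cinner (x - y) m - cnj t * (cinner m (x - y) - t * cinner m m)"
      unfolding cinner.diff_left[of "x - y" "t *\<^sub>C m"] cinner.diff_right[of _ "x - y" "t *\<^sub>C m"]
        cinner_scaleC_left cinner_scaleC_right
      by (simp add: right_diff_distrib)
    also have "cinner m (x - y) - t * cinner m m = 0"
      using False by (simp add: t_def)
    also have "t * cinner (x - y) m = of_real ((cmod (cinner m (x - y)))\<^sup>2 / (norm m)\<^sup>2)"
      using complex_norm_square[of "cinner m (x - y)"]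
      by (simp add: t_def cinner_commute[of "x - y" m] cinner_self)
    finally have "(cmod (cinner m (x - y)))\<^sup>2 / (norm m)\<^sup>2 \<le> 0"
      by simp
    thus ?thesis
      using False by (simp add: divide_le_0_iff)
  qed (simp add: cinner.zero_left)
  with y(1) show ?thesis
    by (intro that) (auto simp: corthogonal_def)
qed

text \<open>Two candidates differ by a vector that lies in \<open>M\<close> and in its orthogonal
  complement, hence by zero; this settles the \<open>THE\<close> in
  \<open>projection\<close>.\<close>

lemma projection_eqI:
  assumes "csubspace M" "y \<in> M" "x - y \<in> corthogonal M"
  shows "projection M x = y"
  unfolding projection_def
proof (rule the_equality)
  fix z assume z: "z \<in> M \<and> x - z \<in> corthogonal M"
  have "y - z \<in> M"
    using assms z by (simp add: complex_vector.subspace_diff)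
  moreover have "(x - z) - (x - y) \<in> corthogonal M"
    by (rule complex_vector.subspace_diff[OF csubspace_corthogonal]) (use assms z in simp_all)
  hence "y - z \<in> corthogonal M"
    by simp
  ultimately show "z = y"
    using corthogonal_Int[of "y - z" M] by simp
qed (use assms in simp)

lemma
  fixes M :: "'a::chilbert_space set"
  assumes "closed_csubspace M"
  shows projection_in: "projection M x \<in> M"
    and diff_projection: "x - projection M x \<in> corthogonal M"
proof -
  obtain y where "y \<in> M" "x - y \<in> corthogonal M"
    using orthogonal_decomposition[OF assms] .
  moreover from this have "projection M x = y"
    using assms by (intro projection_eqI) (auto simp: closed_csubspace_def)
  ultimately show "projection M x \<in> M" "x - projection M x \<in> corthogonal M"
    by auto
qed

lemma cinner_projection:
  fixes M :: "'a::chilbert_space set"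
  assumes "closed_csubspace M" "m \<in> M"
  shows "cinner m (projection M x) = cinner m x"
  using diff_projection[OF assms(1), of x] assms(2)
  by (auto simp: corthogonal_def cinner.diff_right)

lemma projection_add:
  fixes M :: "'a::chilbert_space set"
  assumes "closed_csubspace M"
  shows "projection M (x + y) = projection M x + projection M y"
proof (rule projection_eqI)
  have "(x - projection M x) + (y - projection M y) \<in> corthogonal M"
    by (intro complex_vector.subspace_add csubspace_corthogonal diff_projection assms)
  thus "x + y - (projection M x + projection M y) \<in> corthogonal M"
    by (simp add: algebra_simps)
qed (use assms in \<open>auto simp: closed_csubspace_def intro!: complex_vector.subspace_add projection_in\<close>)

lemma projection_scaleC:
  fixes M :: "'a::chilbert_space set"
  assumes "closed_csubspace M"
  shows "projection M (c *\<^sub>C x) = c *\<^sub>C projection M x"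
proof (rule projection_eqI)
  have "c *\<^sub>C (x - projection M x) \<in> corthogonal M"
    by (intro complex_vector.subspace_scale csubspace_corthogonal diff_projection assms)
  thus "c *\<^sub>C x - c *\<^sub>C projection M x \<in> corthogonal M"
    by (simp add: scaleC.diff_right)
qed (use assms in \<open>auto simp: closed_csubspace_def intro!: complex_vector.subspace_scale projection_in\<close>)

text \<open>The remainder \<open>x - projection M x\<close> is orthogonal both to \<open>x\<close>
  and to its projection, hence to itself.\<close>

lemma double_corthogonal:
  fixes M :: "'a::chilbert_space set"
  assumes "closed_csubspace M" "\<And>y. y \<in> corthogonal M \<Longrightarrow> cinner y x = 0"
  shows "x \<in> M"
proof -
  let ?p = "projection M x"
  have "cinner (x - ?p) x = 0"
    by (intro assms diff_projection)
  moreover have "cinner (x - ?p) ?p = 0"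
    using diff_projection[OF assms(1), of x] projection_in[OF assms(1), of x]
    by (subst cinner_commute) (auto simp: corthogonal_def)
  ultimately have "cinner (x - ?p) (x - ?p) = 0"
    by (simp add: cinner.diff_right)
  thus ?thesis
    using projection_in[OF assms(1), of x] by simp
qed

lemma corthogonal_closure: "corthogonal (closure M) = corthogonal M"
proof -
  have "cinner y x = 0" if "\<And>y. y \<in> M \<Longrightarrow> cinner y x = 0" "y \<in> closure M" for x y
  proof -
    have "closed ((\<lambda>y. cinner y x) -` {0})"
      by (intro continuous_closed_vimage) (auto intro!: continuous_intros cinner.continuous)
    hence "closure M \<subseteq> (\<lambda>y. cinner y x) -` {0}"
      using that by (intro closure_minimal) auto
    thus ?thesis using that by auto
  qed
  thus ?thesis
    using closure_subset[of M] by (auto simp: corthogonal_def)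
qed

lemma closed_csubspace_closure:
  fixes M :: "'a::complex_inner set"
  assumes "csubspace M"
  shows "closed_csubspace (closure M)"
proof -
  have "x + y \<in> closure M" if xy: "x \<in> closure M" "y \<in> closure M" for x y
  proof -
    obtain X Y where "\<And>n. X n \<in> M" "X \<longlonglongrightarrow> x" "\<And>n. Y n \<in> M" "Y \<longlonglongrightarrow> y"
      using xy unfolding closure_sequential by metis
    thus ?thesis
      unfolding closure_sequential
      by (intro exI[of _ "\<lambda>n. X n + Y n"])
        (auto intro!: tendsto_add complex_vector.subspace_add assms)
  qed
  moreover have "c *\<^sub>C x \<in> closure M" if x: "x \<in> closure M" for c x
  proof -
    obtain X where "\<And>n. X n \<in> M" "X \<longlonglongrightarrow> x"
      using x unfolding closure_sequential by metis
    thus ?thesis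
      unfolding closure_sequential
      by (intro exI[of _ "\<lambda>n. c *\<^sub>C X n"])
        (auto intro!: scaleC.tendsto complex_vector.subspace_scale assms)
  qed
  moreover have "0 \<in> closure M"
    using complex_vector.subspace_0[OF assms] closure_subset by auto
  ultimately show ?thesis
    by (auto simp: closed_csubspace_def complex_vector.subspace_def)
qed

subsection \<open>Adjoints\<close>

lemma bounded_clinearD:
  assumes "bounded_clinear A"
  shows "bounded_linear A" "A (x + y) = A x + A y" "A (c *\<^sub>C x) = c *\<^sub>C A x" "A 0 = 0"
    "A (x - y) = A x - A y" "A (sum f I) = (\<Sum>i\<in>I. A (f i))"
  using assms
  by (auto simp: bounded_clinear_def bounded_linear.linear linear_add linear_0 linear_diff linear_sum)

text \<open>The representing vector is a multiple of a vector \<open>u\<close> orthogonal to the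
  kernel: \<open>F u *\<^sub>C x - F x *\<^sub>C u\<close> lies in the kernel, and its orthogonality
  to \<open>u\<close> determines \<open>F x\<close>.\<close>

lemma riesz:
  fixes F :: "'a::chilbert_space \<Rightarrow> complex"
  assumes "bounded_clinear F"
  obtains a where "\<And>x. F x = cinner a x"
proof (cases "\<forall>x. F x = 0")
  case True
  thus ?thesis by (intro that[of 0]) (simp add: cinner.zero_left)
next
  case False
  then obtain z where z: "F z \<noteq> 0" by auto
  note F = bounded_clinearD[OF assms]
  have "closed_csubspace (F -` {0})"
    unfolding closed_csubspace_def
  proof
    show "closed (F -` {0})"
      by (intro continuous_closed_vimage) (auto intro!: linear_continuous_at F)
    show "csubspace (F -` {0})"
      by (auto simp: complex_vector.subspace_def F scaleC_complex_def)
  qed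
  from orthogonal_decomposition[OF this, of z] obtain y
    where y: "F y = 0" "z - y \<in> corthogonal (F -` {0})"
    by auto
  define u where "u = z - y"
  have u: "F u \<noteq> 0" "cinner v u = 0" if "F v = 0" for v
    using y z that by (auto simp: u_def F corthogonal_def)
  have u0: "F u \<noteq> 0"
    using u(1)[OF F(4)] .
  hence u1: "u \<noteq> 0"
    using F(4) by auto
  show ?thesis
  proof (rule that[of "cnj (F u / cinner u u) *\<^sub>C u"])
    fix x
    have "F (F u *\<^sub>C x - F x *\<^sub>C u) = 0"
      by (simp add: F scaleC_complex_def)
    from u(2)[OF this] have "cinner u (F u *\<^sub>C x - F x *\<^sub>C u) = 0"
      by (subst cinner_commute) simp
    hence "F u * cinner u x = F x * cinner u u"
      by (simp add: cinner.diff_right cinner_scaleC_right)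
    thus "F x = cinner (cnj (F u / cinner u u) *\<^sub>C u) x"
      using u1 by (simp add: cinner_scaleC_left field_simps)
  qed
qed

lemma cadj_eqI:
  assumes "\<And>x y. cinner (A x) y = cinner x (B y)"
  shows "cadj A = B"
  unfolding cadj_def
proof (rule the_equality)
  fix C assume C: "\<forall>x y. cinner (A x) y = cinner x (C y)"
  show "C = B"
    by (rule ext, rule cinner_ext) (metis C assms)
qed (use assms in simp)

text \<open>For each \<open>y\<close>, \<open>riesz\<close> represents the functional
  \<open>cinner y (A x)\<close> of \<open>x\<close> by a vector; these vectors form the adjoint,
  which \<open>cadj_eqI\<close> identifies with \<open>cadj A\<close>.\<close>

lemma cinner_cadj:
  fixes A :: "'a::chilbert_space \<Rightarrow> 'b::complex_inner"
  assumes "bounded_clinear A"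
  shows "cinner x (cadj A y) = cinner (A x) y"
proof -
  note A = bounded_clinearD[OF assms]
  have "\<exists>a. \<forall>x. cinner y (A x) = cinner a x" for y
  proof -
    have "bounded_clinear (\<lambda>x. cinner y (A x))"
      unfolding bounded_clinear_def
      using bounded_linear_compose[OF cinner.bounded_linear_right A(1)]
      by (simp add: A cinner_scaleC_right scaleC_complex_def)
    thus ?thesis
      using riesz by metis
  qed
  then obtain B where B: "\<And>x y. cinner y (A x) = cinner (B y) x"
    by metis
  have "cinner (A x) y = cinner x (B y)" for x y
    using B[of y x] by (metis cinner_commute)
  with cadj_eqI[of A B] show ?thesis
    by simp
qed

lemma cinner_cadj_left:
  fixes A :: "'a::chilbert_space \<Rightarrow> 'b::complex_inner"
  assumes "bounded_clinear A"
  shows "cinner (cadj A y) x = cinner y (A x)"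
  using cinner_cadj[OF assms, of x y] by (metis cinner_commute)

subsection \<open>Finite-dimensional subspaces\<close>

text \<open>A Gram-Schmidt induction: with the new vector replaced by its component \<open>b\<close>
  orthogonal to the old span, the coefficient along \<open>b\<close> is a continuous function, so
  the new span is the preimage of the old one under a continuous map.\<close>

lemma closed_cspan_finite:
  fixes S :: "'a::chilbert_space set"
  assumes "finite S"
  shows "closed_csubspace (cspan S)"
  using assms
proof (induction S)
  case empty
  show ?case by (simp add: closed_csubspace_def complex_vector.subspace_0)
next
  case (insert a S)
  let ?M = "cspan S"
  define b where "b = a - projection ?M a"
  have sub: "csubspace ?M"
    by simp
  have b: "b \<in> corthogonal ?M" and pa: "projection ?M a \<in> ?M"
    unfolding b_def by (intro diff_projection projection_in insert.IH)+
  have eq: "cspan (insert a S) = {x. \<exists>k. x - k *\<^sub>C b \<in> ?M}"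
  proof -
    have "x - k *\<^sub>C a \<in> ?M \<longleftrightarrow> x - k *\<^sub>C b \<in> ?M" for x k
    proof -
      have kp: "k *\<^sub>C projection ?M a \<in> ?M"
        by (intro complex_vector.span_scale pa)
      have "x - k *\<^sub>C b = (x - k *\<^sub>C a) + k *\<^sub>C projection ?M a"
        by (simp add: b_def scaleC.diff_right)
      thus ?thesis
        using complex_vector.span_add_eq2[OF kp] by metis
    qed
    thus ?thesis
      by (simp add: complex_vector.span_insert)
  qed
  \<comment> \<open>If \<open>b = 0\<close>, division by zero gives the coefficient \<open>0\<close>
    and the map is the identity.\<close>
  have "{x. \<exists>k. x - k *\<^sub>C b \<in> ?M} = (\<lambda>x. x - (cinner b x / cinner b b) *\<^sub>C b) -` ?M"
  proof -
    have "x - (cinner b x / cinner b b) *\<^sub>C b \<in> ?M" if "x - k *\<^sub>C b \<in> ?M" for x k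
    proof (cases "b = 0")
      case False
      have "cinner (x - k *\<^sub>C b) b = 0"
        using b that by (auto simp: corthogonal_def)
      hence "cinner b (x - k *\<^sub>C b) = 0"
        by (subst cinner_commute) simp
      hence "k = cinner b x / cinner b b"
        using False by (simp add: cinner.diff_right cinner_scaleC_right)
      thus ?thesis using that by simp
    qed (use that in simp)
    thus ?thesis by auto
  qed
  moreover have "closed \<dots>"
  proof (rule continuous_closed_vimage)
    show "closed ?M"
      using insert.IH by (simp add: closed_csubspace_def)
    show "isCont (\<lambda>x. x - (cinner b x / cinner b b) *\<^sub>C b) x" for x
      by (cases "b = 0")
        (auto intro!: continuous_intros scaleC.continuous cinner.continuous)
  qed
  ultimately have "closed (cspan (insert a S))"
    unfolding eq by simp
  thus ?case
    by (simp add: closed_csubspace_def)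
qed

text \<open>The dimension is compared with the number of indices, so the condition also excludes
  repeated vectors and expresses independence of the family, not just of its range.\<close>

lemma independent_family_iff:
  fixes v :: "'i \<Rightarrow> 'a::complex_inner"
  assumes "finite I"
  shows "cdim (v ` I) = card I \<longleftrightarrow> (\<forall>c. (\<Sum>i\<in>I. c i *\<^sub>C v i) = 0 \<longrightarrow> (\<forall>i\<in>I. c i = 0))"
proof
  assume dim: "cdim (v ` I) = card I"
  have "cdim (v ` I) \<le> card (v ` I)"
    using assms by (intro complex_vector.dim_le_card') auto
  hence card: "card (v ` I) = card I"
    using card_image_le[OF assms, of v] dim by simp
  hence inj: "inj_on v I"
    using assms by (simp add: inj_on_iff_eq_card)
  have indep: "\<not> cdependent (v ` I)"
  proof
    assume "cdependent (v ` I)"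
    then obtain a where a: "a \<in> v ` I" "a \<in> cspan (v ` I - {a})"
      by (auto simp: complex_vector.dependent_def)
    hence "v ` I \<subseteq> cspan (v ` I - {a})"
      by (metis Diff_subset complex_vector.span_base insertE insert_Diff subsetI)
    hence "cdim (v ` I) \<le> card (v ` I - {a})"
      using assms by (intro complex_vector.dim_le_card) auto
    also have "\<dots> < card (v ` I)"
      using a(1) assms by (intro psubset_card_mono) auto
    finally show False
      using dim card by simp
  qed
  show "\<forall>c. (\<Sum>i\<in>I. c i *\<^sub>C v i) = 0 \<longrightarrow> (\<forall>i\<in>I. c i = 0)"
  proof (intro allI impI ballI)
    fix c i assume c: "(\<Sum>i\<in>I. c i *\<^sub>C v i) = 0" and i: "i \<in> I"
    have "(\<Sum>x\<in>v ` I. c (the_inv_into I v x) *\<^sub>C x) = (\<Sum>i\<in>I. c i *\<^sub>C v i)"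
      using inj by (simp add: sum.reindex the_inv_into_f_f)
    hence "c (the_inv_into I v (v i)) = 0"
      using complex_vector.independentD[OF indep, of "v ` I" "\<lambda>x. c (the_inv_into I v x)" "v i"]
        c i assms by auto
    thus "c i = 0"
      using inj i by (simp add: the_inv_into_f_f)
  qed
next
  assume *: "\<forall>c. (\<Sum>i\<in>I. c i *\<^sub>C v i) = 0 \<longrightarrow> (\<forall>i\<in>I. c i = 0)"
  have inj: "inj_on v I"
  proof (rule inj_onI, rule ccontr)
    fix i j assume ij: "i \<in> I" "j \<in> I" "v i = v j" "i \<noteq> j"
    let ?c = "\<lambda>k. if k = i then 1 else if k = j then -1 else 0"
    have "(\<Sum>k\<in>I. ?c k *\<^sub>C v k) = (\<Sum>k\<in>{i, j}. ?c k *\<^sub>C v k)"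
      using ij assms by (intro sum.mono_neutral_right) auto
    also have "\<dots> = 0"
      using ij by simp
    finally show False
      using *[rule_format, of ?c i] ij(1) by simp
  qed
  have "\<not> cdependent (v ` I)"
  proof
    assume "cdependent (v ` I)"
    then obtain u where u: "\<exists>x\<in>v ` I. u x \<noteq> 0" "(\<Sum>x\<in>v ` I. u x *\<^sub>C x) = 0"
      using assms by (auto simp: complex_vector.dependent_finite)
    hence "(\<Sum>i\<in>I. u (v i) *\<^sub>C v i) = 0"
      using inj by (simp add: sum.reindex)
    from *[rule_format, OF this] u(1) show False
      by auto
  qed
  thus "cdim (v ` I) = card I"
    using inj by (simp add: complex_vector.dim_eq_card_independent card_image)
qed

lemma cdimension_cspan:
  assumes "finite I"
  shows "cdimension (cspan (v ` I)) = enat (cdim (v ` I))"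
  using assms by (auto simp: cdimension_def intro!: exI[of _ "v ` I"])

lemma cspan_image:
  assumes "\<And>x y. f (x + y) = f x + f y" "\<And>c x. f (c *\<^sub>C x) = c *\<^sub>C f x"
  shows "f ` cspan S = cspan (f ` S)"
proof -
  interpret vector_space_pair "scaleC :: complex \<Rightarrow> 'a \<Rightarrow> 'a" "scaleC :: complex \<Rightarrow> 'b \<Rightarrow> 'b" ..
  have "Vector_Spaces.linear scaleC scaleC f"
    by unfold_locales (use assms in auto)
  from linear_span_image[OF this, of S] show ?thesis
    by (simp add: cspan_def)
qed

text \<open>If \<open>y\<close> is orthogonal to the range, then the quadratic form at
  \<open>y\<close>, a sum of squared moduli of \<open>cinner (v i) y\<close>, vanishes; so
  \<open>y\<close> is orthogonal to every \<open>v i\<close> and \<open>double_corthogonal\<close>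
  applies. The other inclusion holds because finite spans are closed.\<close>

lemma closure_range_frame_operator:
  fixes v :: "'i \<Rightarrow> 'a::chilbert_space"
  assumes "finite I"
  shows "closure (range (\<lambda>x. \<Sum>i\<in>I. cinner (v i) x *\<^sub>C v i)) = cspan (v ` I)"
    (is "closure (range ?B) = ?M")
proof
  have "range ?B \<subseteq> ?M"
    by (auto intro!: complex_vector.span_sum complex_vector.span_scale intro: complex_vector.span_base)
  thus "closure (range ?B) \<subseteq> ?M"
    using closed_cspan_finite[of "v ` I"] assms
    by (intro closure_minimal) (auto simp: closed_csubspace_def)
  have "csubspace (range ?B)"
    unfolding complex_vector.subspace_def
  proof (intro conjI ballI allI)
    show "0 \<in> range ?B"
      by (rule range_eqI[of _ _ 0]) (simp add: cinner.zero_right)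
    fix x y c assume "x \<in> range ?B" "y \<in> range ?B"
    then obtain a b where ab: "x = ?B a" "y = ?B b" by auto
    show "x + y \<in> range ?B"
      by (rule range_eqI[of _ _ "a + b"])
        (simp add: ab cinner_add_right scaleC_add_left sum.distrib)
  next
    fix x c assume "x \<in> range ?B"
    then obtain a where a: "x = ?B a" by auto
    show "c *\<^sub>C x \<in> range ?B"
      by (rule range_eqI[of _ _ "c *\<^sub>C a"])
        (simp add: a cinner_scaleC_right scaleC.sum_right scaleC_scaleC)
  qed
  hence cl: "closed_csubspace (closure (range ?B))"
    by (rule closed_csubspace_closure)
  have "v i \<in> closure (range ?B)" if i: "i \<in> I" for i
  proof (rule double_corthogonal[OF cl])
    fix y assume "y \<in> corthogonal (closure (range ?B))"
    hence "y \<in> corthogonal (range ?B)"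
      by (simp only: corthogonal_closure)
    hence "cinner (?B y) y = 0"
      by (auto simp: corthogonal_def)
    hence "(\<Sum>i\<in>I. cnj (cinner (v i) y) * cinner (v i) y) = 0"
      by (simp add: cinner.sum_left cinner_scaleC_left)
    also have "(\<Sum>i\<in>I. cnj (cinner (v i) y) * cinner (v i) y)
        = of_real (\<Sum>i\<in>I. (cmod (cinner (v i) y))\<^sup>2)"
      by (simp add: complex_norm_square mult.commute flip: of_real_power)
    finally have "(\<Sum>i\<in>I. (cmod (cinner (v i) y))\<^sup>2) = 0"
      using of_real_eq_0_iff by blast
    hence "cinner (v i) y = 0"
      using assms i by (simp add: sum_nonneg_eq_0_iff)
    thus "cinner y (v i) = 0"
      by (subst cinner_commute) simp
  qed
  thus "?M \<subseteq> closure (range ?B)"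
    using cl by (intro complex_vector.span_minimal) (auto simp: closed_csubspace_def)
qed

subsection \<open>Square-summable families and the Fock space\<close>

lemma ell2_eqI: "(\<And>w. ell2_nth x w = ell2_nth y w) \<Longrightarrow> x = y"
  by (simp add: ell2_nth_inject[symmetric] fun_eq_iff)

lemma ell2_nth_sum: "ell2_nth (sum f I) w = (\<Sum>i\<in>I. ell2_nth (f i) w)"
  by (induction I rule: infinite_finite_induct) (simp_all add: zero_ell2.rep_eq plus_ell2.rep_eq)

lemma cinner_basis_vec: "cinner (basis_vec w) \<psi> = ell2_nth \<psi> w"
proof -
  have "cinner (basis_vec w) \<psi> = infsum (\<lambda>i. if i = w then ell2_nth \<psi> i else 0) UNIV"
    unfolding cinner_ell2_def
    by (intro infsum_cong) (simp add: basis_vec.rep_eq cinner_complex_def)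
  also have "\<dots> = infsum (\<lambda>i. if i = w then ell2_nth \<psi> i else 0) {w}"
    by (rule infsum_cong_neutral) auto
  finally show ?thesis by simp
qed

lemma cinner_basis_vec_right: "cinner \<psi> (basis_vec w) = cnj (ell2_nth \<psi> w)"
  by (metis cinner_basis_vec cinner_commute)

lemma tensor_add_left: "(\<psi> + \<phi>) \<otimes>\<^sub>h \<xi> = \<psi> \<otimes>\<^sub>h \<xi> + \<phi> \<otimes>\<^sub>h \<xi>"
  by (rule ell2_eqI) (simp add: tensor.rep_eq plus_ell2.rep_eq scaleC_add_left)

lemma tensor_scaleC_left: "(c *\<^sub>C \<psi>) \<otimes>\<^sub>h \<xi> = c *\<^sub>C (\<psi> \<otimes>\<^sub>h \<xi>)"
  by (rule ell2_eqI) (simp add: tensor.rep_eq scaleC_ell2.rep_eq scaleC_scaleC scaleC_complex_def)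

lemma tensor_scaleC_right: "\<psi> \<otimes>\<^sub>h (c *\<^sub>C \<xi>) = c *\<^sub>C (\<psi> \<otimes>\<^sub>h \<xi>)"
  by (rule ell2_eqI) (simp add: tensor.rep_eq scaleC_ell2.rep_eq scaleC_scaleC mult.commute)

text \<open>Pythagoras: the remainder keeps the coordinates of \<open>\<phi>\<close> off
  \<open>F\<close> and vanishes on \<open>F\<close>.\<close>

lemma norm_diff_partial_ell2:
  assumes "finite F"
  shows "(norm (\<phi> - (\<Sum>w\<in>F. basis_vec w \<otimes>\<^sub>h ell2_nth \<phi> w)))\<^sup>2
    = (norm \<phi>)\<^sup>2 - (\<Sum>w\<in>F. (norm (ell2_nth \<phi> w))\<^sup>2)"
proof -
  let ?f = "\<lambda>w. (norm (ell2_nth \<phi> w))\<^sup>2"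
  have p: "ell2_nth (\<Sum>w\<in>F. basis_vec w \<otimes>\<^sub>h ell2_nth \<phi> w) u = (if u \<in> F then ell2_nth \<phi> u else 0)"
    for u
  proof -
    have "ell2_nth (\<Sum>w\<in>F. basis_vec w \<otimes>\<^sub>h ell2_nth \<phi> w) u
        = (\<Sum>w\<in>F. if u = w then ell2_nth \<phi> u else 0)"
      unfolding ell2_nth_sum by (intro sum.cong) (auto simp: tensor.rep_eq basis_vec.rep_eq)
    thus ?thesis using assms by (simp add: sum.delta')
  qed
  have "(norm (\<phi> - (\<Sum>w\<in>F. basis_vec w \<otimes>\<^sub>h ell2_nth \<phi> w)))\<^sup>2 = infsum ?f (UNIV - F)"
    unfolding norm_ell2_power2 minus_ell2.rep_eq p
    by (rule infsum_cong_neutral) auto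
  also have "\<dots> = infsum ?f UNIV - infsum ?f F"
    using assms by (intro infsum_Diff ell2_summable) auto
  finally show ?thesis
    using assms by (simp add: norm_ell2_power2)
qed

text \<open>The squared norms of the coordinates sum to that of \<open>\<phi>\<close>, so the
  remainders tend to zero. This evaluates the series defining \<open>poisson_kernel\<close> from its
  coordinates.\<close>

lemma has_sum_ell2: "((\<lambda>w. basis_vec w \<otimes>\<^sub>h ell2_nth \<phi> w) has_sum \<phi>) UNIV"
  unfolding has_sum_def tendsto_iff
proof (intro allI impI)
  fix e :: real assume "e > 0"
  have "((\<lambda>w. (norm (ell2_nth \<phi> w))\<^sup>2) has_sum (norm \<phi>)\<^sup>2) UNIV"
    unfolding norm_ell2_power2 by (rule has_sum_infsum[OF ell2_summable])
  hence "\<forall>\<^sub>F F in finite_subsets_at_top UNIV.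
      dist (\<Sum>w\<in>F. (norm (ell2_nth \<phi> w))\<^sup>2) ((norm \<phi>)\<^sup>2) < e\<^sup>2"
    unfolding has_sum_def tendsto_iff using \<open>e > 0\<close> by simp
  moreover have "\<forall>\<^sub>F F in finite_subsets_at_top (UNIV :: 'a set). finite F"
    by (rule eventually_finite_subsets_at_top_weakI)
  ultimately show "\<forall>\<^sub>F F in finite_subsets_at_top UNIV.
      dist (\<Sum>w\<in>F. basis_vec w \<otimes>\<^sub>h ell2_nth \<phi> w) \<phi> < e"
  proof eventually_elim
    case (elim F)
    have "(norm (\<phi> - (\<Sum>w\<in>F. basis_vec w \<otimes>\<^sub>h ell2_nth \<phi> w)))\<^sup>2 < e\<^sup>2"
      using elim(1) by (simp add: norm_diff_partial_ell2[OF elim(2)] dist_real_def abs_less_iff)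
    hence "norm (\<phi> - (\<Sum>w\<in>F. basis_vec w \<otimes>\<^sub>h ell2_nth \<phi> w)) < e"
      using \<open>e > 0\<close> by (simp add: power_less_imp_less_base)
    thus ?case
      by (simp add: dist_norm norm_minus_commute)
  qed
qed

text \<open>The strict bound matches the index sets of the defect spaces: degree at most
  \<open>n\<close> corresponds to the defect space of index \<open>n + 1\<close>.\<close>

lemma fock_upto_eq: "fock_upto n = cspan (basis_vec ` {w. length w < Suc n})"
  unfolding fock_upto_def by (rule arg_cong[where f = cspan]) (auto simp: less_Suc_eq_le)

lemma creation_diff: "creation i (\<psi> - \<phi>) = creation i \<psi> - creation i \<phi>"
  by (rule ell2_eqI) (auto simp: creation.rep_eq minus_ell2.rep_eq split: list.split)

text \<open>The adjoint of \<open>creation i\<close>, as \<open>cinner_annihilation\<close> shows,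
  given by coordinates rather than by the \<open>THE\<close> in \<open>cadj\<close>.\<close>

lift_definition annihilation :: "'d \<Rightarrow> 'd fock \<Rightarrow> 'd fock" is "\<lambda>i \<psi> w. \<psi> (i # w)"
proof -
  fix i :: 'd and \<psi> :: "'d list \<Rightarrow> complex"
  assume "(\<lambda>w. (cmod (\<psi> w))\<^sup>2) summable_on UNIV"
  hence "(\<lambda>w. (cmod (\<psi> w))\<^sup>2) summable_on range (Cons i)"
    by (rule summable_on_subset_banach) simp
  thus "(\<lambda>w. (cmod (\<psi> (i # w)))\<^sup>2) summable_on UNIV"
    by (subst (asm) summable_on_reindex) (auto simp: o_def inj_on_def)
qed

lemma cinner_annihilation: "cinner (annihilation i \<psi>) \<phi> = cinner \<psi> (creation i \<phi>)"
proof -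
  have "cinner \<psi> (creation i \<phi>)
      = infsum (\<lambda>w. cinner (ell2_nth \<psi> w) (ell2_nth (creation i \<phi>) w)) (range (Cons i))"
    unfolding cinner_ell2_def
    by (rule infsum_cong_neutral)
      (auto simp: creation.rep_eq cinner_complex_def split: list.splits)
  also have "\<dots> = cinner (annihilation i \<psi>) \<phi>"
    unfolding cinner_ell2_def
    by (subst infsum_reindex) (auto simp: o_def creation.rep_eq annihilation.rep_eq)
  finally show ?thesis ..
qed

text \<open>Weak form of the fact that the identity of the Fock space is the vacuum projection plus
  the sum over \<open>i\<close> of \<open>creation i\<close> composed with its adjoint.\<close>

lemma cinner_fock_split:
  fixes \<psi> \<phi> :: "'d::finite fock"
  shows "cinner \<psi> \<phi> = cnj (ell2_nth \<psi> []) * ell2_nth \<phi> []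
    + (\<Sum>i\<in>UNIV. cinner (annihilation i \<psi>) (annihilation i \<phi>))"
proof -
  have "\<phi> = ell2_nth \<phi> [] *\<^sub>C basis_vec [] + (\<Sum>i\<in>UNIV. creation i (annihilation i \<phi>))"
  proof (rule ell2_eqI)
    fix w
    show "ell2_nth \<phi> w = ell2_nth
        (ell2_nth \<phi> [] *\<^sub>C basis_vec [] + (\<Sum>i\<in>UNIV. creation i (annihilation i \<phi>))) w"
      by (cases w)
        (simp_all add: plus_ell2.rep_eq scaleC_ell2.rep_eq basis_vec.rep_eq ell2_nth_sum
          creation.rep_eq annihilation.rep_eq scaleC_complex_def)
  qed
  hence "cinner \<psi> \<phi> = cinner \<psi>
      (ell2_nth \<phi> [] *\<^sub>C basis_vec [] + (\<Sum>i\<in>UNIV. creation i (annihilation i \<phi>)))"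
    by simp
  thus ?thesis
    by (simp add: cinner_add_right cinner_scaleC_right cinner.sum_right cinner_annihilation
        cinner_basis_vec_right)
qed

subsection \<open>Words\<close>

lemma finite_words_less [simp]: "finite {w :: 'd::finite list. length w < n}"
  by (rule finite_subset[OF _ finite_lists_length_le[of UNIV n]]) auto

lemma card_words_less: "card {w :: 'd::finite list. length w < n} = (\<Sum>k<n. CARD('d) ^ k)"
proof (cases n)
  case (Suc m)
  have "{w :: 'd list. length w < n} = {w. set w \<subseteq> UNIV \<and> length w \<le> m}"
    by (auto simp: Suc)
  thus ?thesis
    using card_lists_length_le[of "UNIV :: 'd set" m] by (simp add: Suc lessThan_Suc_atMost)
qed simp

text \<open>A word is empty or a letter followed by a shorter word; prefixing a letter mirrors one
  application of \<open>Psi\<close>.\<close>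

lemma sum_words_less_Suc:
  fixes f :: "'d::finite list \<Rightarrow> 'a::comm_monoid_add"
  shows "(\<Sum>w | length w < Suc n. f w) = f [] + (\<Sum>i\<in>UNIV. \<Sum>w | length w < n. f (i # w))"
proof -
  have "{w :: 'd list. length w < Suc n}
      = insert [] ((\<lambda>(i, w). i # w) ` (UNIV \<times> {w. length w < n}))"
    (is "_ = insert _ ?S")
    by (auto simp: image_iff less_Suc_eq_0_disj length_Suc_conv)
  hence "(\<Sum>w | length w < Suc n. f w) = f [] + sum f ?S"
    by (simp only:) (rule sum.insert, auto)
  also have "sum f ?S = (\<Sum>i\<in>UNIV. \<Sum>w | length w < n. f (i # w))"
    by (subst sum.reindex) (auto simp: inj_on_def sum.cartesian_product case_prod_unfold)
  finally show ?thesis .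
qed

text \<open>Turns an unconditional sum over all words into the limit of its partial sums by
  length.\<close>

lemma filterlim_words_less:
  "filterlim (\<lambda>n. {w :: 'd::finite list. length w < n}) (finite_subsets_at_top UNIV) sequentially"
  unfolding filterlim_finite_subsets_at_top
proof (intro allI impI)
  fix X :: "'d list set" assume X: "finite X \<and> X \<subseteq> UNIV"
  have "length w < n" if "w \<in> X" "Suc (Max (length ` X)) \<le> n" for w n
  proof -
    have "length w \<le> Max (length ` X)"
      using that X by (intro Max_ge) auto
    thus ?thesis using that by simp
  qed
  hence "\<forall>n\<ge>Suc (Max (length ` X)).
      finite {w :: 'd list. length w < n} \<and> X \<subseteq> {w. length w < n} \<and> {w. length w < n} \<subseteq> UNIV"
    by auto
  thus "\<forall>\<^sub>F n in sequentially.
      finite {w :: 'd list. length w < n} \<and> X \<subseteq> {w. length w < n} \<and> {w. length w < n} \<subseteq> UNIV"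
    unfolding eventually_sequentially by blast
qed

subsection \<open>Operators of rank one\<close>

text \<open>Polarisation: the quadratic form of \<open>B\<close> is real, and expanding it at
  \<open>x + z\<close> gives the relation \<open>s\<close> between the mixed terms.\<close>

lemma positive_op_selfadjoint:
  assumes "positive_op B"
  shows "cinner (B x) z = cinner x (B z)"
proof -
  have BD: "B (x + y) = B x + B y" "B (c *\<^sub>C x) = c *\<^sub>C B x" for x y c
    using assms by (auto simp: positive_op_def bounded_clinearD)
  have re: "cinner u (B u) = cinner (B u) u" for u
    using assms by (metis Reals_cnj_iff cinner_commute positive_op_def)
  have s: "cinner x (B z) + cinner z (B x) = cinner (B x) z + cinner (B z) x" for x z
    using re[of "x + z"] re[of x] re[of z]
    by (simp add: BD cinner_add_left cinner_add_right algebra_simps)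
  \<comment> \<open>With \<open>\<i> *\<^sub>C z\<close> in place of \<open>z\<close> the sums in
    \<open>s\<close> become differences; the two relations together isolate
    \<open>cinner x (B z)\<close>.\<close>
  have "cinner x (B (\<i> *\<^sub>C z)) + cinner (\<i> *\<^sub>C z) (B x) = cinner (B x) (\<i> *\<^sub>C z) + cinner (B (\<i> *\<^sub>C z)) x"
    by (rule s)
  hence "cinner x (B z) - cinner z (B x) = cinner (B x) z - cinner (B z) x"
    by (simp add: BD cinner_scaleC_left cinner_scaleC_right flip: right_diff_distrib)
  with s[of x z] show ?thesis
    by algebra
qed

text \<open>The range lies in the line of some \<open>e\<close>, so
  \<open>A x = a x *\<^sub>C e\<close>; selfadjointness makes \<open>a\<close> a multiple
  \<open>c\<close> of the functional given by \<open>e\<close>, and positivity makes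
  \<open>c\<close> a nonnegative real, whose root is absorbed into \<open>g\<close>.\<close>

lemma positive_rank_one:
  fixes A :: "'a::chilbert_space \<Rightarrow> 'a"
  assumes "positive_op A" and dim: "cdimension (closure (range A)) = 1"
  obtains g where "g \<noteq> 0" "\<And>x. A x = cinner g x *\<^sub>C g"
proof -
  let ?R = "closure (range A)"
  have pos: "bounded_clinear A" "\<And>x. cinner x (A x) \<in> \<real>" "\<And>x. 0 \<le> Re (cinner x (A x))"
    using assms(1) by (auto simp: positive_op_def)
  have "\<exists>B. finite B \<and> ?R \<subseteq> cspan B" "cdim ?R = 1"
    using dim by (auto simp: cdimension_def one_enat_def split: if_splits)
  obtain B where B: "B \<subseteq> ?R" "\<not> cdependent B" "?R \<subseteq> cspan B" "card B = cdim ?R"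
    using complex_vector.basis_exists[of ?R] by blast
  with \<open>cdim ?R = 1\<close> obtain e where e: "B = {e}"
    by (auto simp: card_1_singleton_iff)
  have "e \<noteq> 0"
    using B(2) complex_vector.dependent_zero[of B] by (auto simp: e)
  define a where "a x = cinner e (A x) / cinner e e" for x
  have A: "A x = a x *\<^sub>C e" for x
  proof -
    have "A x \<in> cspan {e}"
      using B(3) closure_subset[of "range A"] by (auto simp: e)
    then obtain k where "A x = k *\<^sub>C e"
      by (auto simp: complex_vector.span_singleton)
    thus ?thesis
      using \<open>e \<noteq> 0\<close> by (simp add: a_def cinner_scaleC_right)
  qed
  define c where "c = cnj (a e) / cinner e e"
  have Ac: "A x = (c * cinner e x) *\<^sub>C e" for x
  proof -
    have "cinner e (A x) = cnj (a e) * cinner e x"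
      by (simp add: A[of e] cinner_scaleC_left flip: positive_op_selfadjoint[OF assms(1)])
    hence "a x = c * cinner e x"
      by (simp add: a_def c_def)
    thus ?thesis
      by (simp only: A[of x])
  qed
  have "cinner e (A e) = c * (cinner e e)\<^sup>2"
    by (simp add: Ac cinner_scaleC_right power2_eq_square)
  also have "\<dots> = of_real ((norm e) ^ 4) * c"
    by (simp add: cinner_self flip: power_mult)
  finally have ce: "cinner e (A e) = of_real ((norm e) ^ 4) * c" .
  have "c = cinner e (A e) / of_real ((norm e) ^ 4)"
    using ce \<open>e \<noteq> 0\<close> by simp
  hence "c \<in> \<real>"
    using pos(2)[of e] by (metis Reals_divide Reals_of_real)
  then obtain r where r: "c = of_real r"
    by (auto elim: Reals_cases)
  have "0 \<le> norm e ^ 4 * r"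
    using pos(3)[of e] ce by (simp add: r)
  hence "r \<ge> 0"
    using \<open>e \<noteq> 0\<close> by (simp add: zero_le_mult_iff)
  have "r \<noteq> 0"
  proof
    assume "r = 0"
    hence "range A = {0}"
      using pos(1) by (auto simp: Ac r)
    hence "cdim ?R = 0"
      using complex_vector.dim_le_card[of "{0 :: 'a}" "{}"] by simp
    with \<open>cdim ?R = 1\<close> show False by simp
  qed
  show ?thesis
  proof (rule that)
    show "sqrt r *\<^sub>R e \<noteq> 0"
      using \<open>e \<noteq> 0\<close> \<open>r \<noteq> 0\<close> by simp
    fix x
    have "complex_of_real (sqrt r) * complex_of_real (sqrt r) = c"
      using \<open>r \<ge> 0\<close> by (simp add: r flip: of_real_mult)
    thus "A x = cinner (sqrt r *\<^sub>R e) x *\<^sub>C (sqrt r *\<^sub>R e)"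
      by (simp add: Ac scaleR_scaleC cinner_scaleC_left scaleC_scaleC mult_ac)
  qed
qed

text \<open>The operator is the square of \<open>norm g\<close> times the projection onto the line
  of \<open>g\<close>, so its root is \<open>norm g\<close> times that projection. Uniqueness: a
  positive root \<open>B\<close> has \<open>g\<close> as eigenvector with eigenvalue
  \<open>norm g\<close> and vanishes on vectors orthogonal to \<open>g\<close>.\<close>

lemma sqrt_op_rank_one:
  fixes g :: "'a::complex_inner"
  assumes "g \<noteq> 0"
  shows "sqrt_op (\<lambda>x. cinner g x *\<^sub>C g) = (\<lambda>x. (cinner g x / of_real (norm g)) *\<^sub>C g)"
    (is "sqrt_op ?A = ?D")
proof -
  have gg: "cinner g g = of_real (norm g) * of_real (norm g)"
    by (simp add: cinner_self power2_eq_square)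
  have ng: "complex_of_real (norm g) \<noteq> 0"
    using assms by simp
  show ?thesis
    unfolding sqrt_op_def
  proof (rule the_equality)
    have "bounded_linear (\<lambda>x. (cinner g x / of_real (norm g)) *\<^sub>C g)"
      by (rule bounded_linear_compose[OF scaleC.bounded_linear_left])
        (rule bounded_linear_compose[OF bounded_linear_divide cinner.bounded_linear_right])
    moreover have "cinner x (?D x) = of_real ((cmod (cinner g x))\<^sup>2 / norm g)" for x
      using complex_norm_square[of "cinner g x"]
      by (simp add: cinner_scaleC_right cinner_commute[of x g] flip: of_real_power)
    ultimately have "positive_op ?D"
      by (simp add: positive_op_def bounded_clinear_def cinner_scaleC_right scaleC_scaleC
          del: of_real_divide)
    moreover have "?D \<circ> ?D = ?A"
      using ng by (auto simp: fun_eq_iff cinner_scaleC_right gg)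
    ultimately show "positive_op ?D \<and> ?D \<circ> ?D = ?A" ..
  next
    fix B assume B: "positive_op B \<and> B \<circ> B = ?A"
    have BB: "B (B x) = cinner g x *\<^sub>C g" for x
      using B by (auto simp: fun_eq_iff)
    have lin: "bounded_clinear B" and pos: "\<And>x. cinner x (B x) \<in> \<real>" "\<And>x. 0 \<le> Re (cinner x (B x))"
      using B by (auto simp: positive_op_def)
    note BD = bounded_clinearD[OF lin]
    \<comment> \<open>Both sides are the third iterate of \<open>B\<close> at
      \<open>x\<close>.\<close>
    have com: "cinner g x *\<^sub>C B g = cinner g (B x) *\<^sub>C g" for x
      using BB[of "B x"] by (simp add: BB BD)
    define b where "b = cinner g (B g) / cinner g g"
    have "B g = (1 / cinner g g) *\<^sub>C (cinner g g *\<^sub>C B g)"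
      using assms by (simp add: scaleC_scaleC)
    also have "\<dots> = b *\<^sub>C g"
      unfolding com by (simp add: scaleC_scaleC b_def)
    finally have Bg: "B g = b *\<^sub>C g" .
    have "b \<in> \<real>"
      unfolding b_def by (intro Reals_divide pos) (simp add: cinner_self)
    then obtain r where r: "b = of_real r"
      by (auto elim: Reals_cases)
    have "r \<ge> 0"
      using pos(2)[of g] assms by (simp add: Bg cinner_scaleC_right r cinner_self zero_le_mult_iff
          flip: of_real_power)
    have "(b * b) *\<^sub>C g = cinner g g *\<^sub>C g"
      using BB[of g] by (simp add: Bg BD scaleC_scaleC)
    hence "b * b = cinner g g"
      using assms by simp
    hence "r * r = norm g * norm g"
      unfolding r gg by (metis of_real_eq_iff of_real_mult)
    hence "r = norm g"
      using \<open>r \<ge> 0\<close> by (metis norm_ge_zero power2_eq_square power2_eq_iff_nonneg)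
    have orth: "B y = 0" if "cinner g y = 0" for y
    proof -
      have "B (B y) = 0"
        by (simp add: BB that)
      have "cinner (B y) (B y) = 0"
        by (simp add: positive_op_selfadjoint[of B] B \<open>B (B y) = 0\<close> cinner.zero_right)
      thus ?thesis by simp
    qed
    show "B = ?D"
    proof
      fix x
      define t where "t = cinner g x / cinner g g"
      have "cinner g (x - t *\<^sub>C g) = 0"
        using assms by (simp add: cinner.diff_right cinner_scaleC_right t_def)
      from orth[OF this] have "B x = t *\<^sub>C B g"
        by (simp add: BD)
      also have "\<dots> = ?D x"
        using ng by (simp add: Bg r \<open>r = norm g\<close> t_def gg scaleC_scaleC)
      finally show "B x = ?D x" .
    qed
  qed
qed

subsection \<open>Pure tuples with rank-one defect\<close>

lemma bounded_clinear_compose: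
  "bounded_clinear A \<Longrightarrow> bounded_clinear B \<Longrightarrow> bounded_clinear (A \<circ> B)"
  by (auto simp: bounded_clinear_def o_def intro: bounded_linear_compose)

lemma bounded_clinear_word_op:
  assumes "\<And>i. bounded_clinear (T i)"
  shows "bounded_clinear (word_op T w)"
proof (induction w)
  case Nil
  show ?case by (simp add: bounded_clinear_def id_def bounded_linear_ident)
qed (unfold word_op.simps, intro bounded_clinear_compose assms)

text \<open>The coefficients are indexed by \<open>I\<close>, which allows \<open>v\<close> to
  repeat vectors.\<close>

lemma cspan_imageE:
  assumes "finite I" "x \<in> cspan (v ` I)"
  obtains c where "x = (\<Sum>i\<in>I. c i *\<^sub>C v i)"
proof -
  have "cspan (v ` I) \<subseteq> {x. \<exists>c. x = (\<Sum>i\<in>I. c i *\<^sub>C v i)}"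
  proof (rule complex_vector.span_minimal)
    have "v j = (\<Sum>i\<in>I. (if i = j then 1 else 0) *\<^sub>C v i)" if "j \<in> I" for j
      using assms(1) that by (simp add: if_distrib[where f = "\<lambda>c. c *\<^sub>C _"] cong: if_cong)
    hence "\<exists>c. v j = (\<Sum>i\<in>I. c i *\<^sub>C v i)" if "j \<in> I" for j
      using that by (intro exI[of _ "\<lambda>i. if i = j then 1 else 0"]) simp
    thus "v ` I \<subseteq> {x. \<exists>c. x = (\<Sum>i\<in>I. c i *\<^sub>C v i)}"
      by auto
    show "csubspace {x. \<exists>c. x = (\<Sum>i\<in>I. c i *\<^sub>C v i)}" (is "csubspace ?S")
    proof (rule complex_vector.subspaceI)
      show "0 \<in> ?S"
        by (intro CollectI exI[of _ "\<lambda>_. 0"]) simp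
    next
      fix x y assume "x \<in> ?S" "y \<in> ?S"
      then obtain c d where "x = (\<Sum>i\<in>I. c i *\<^sub>C v i)" "y = (\<Sum>i\<in>I. d i *\<^sub>C v i)"
        by auto
      thus "x + y \<in> ?S"
        by (intro CollectI exI[of _ "\<lambda>i. c i + d i"]) (simp add: scaleC_add_left sum.distrib)
    next
      fix k x assume "x \<in> ?S"
      then obtain c where "x = (\<Sum>i\<in>I. c i *\<^sub>C v i)"
        by auto
      thus "k *\<^sub>C x \<in> ?S"
        by (intro CollectI exI[of _ "\<lambda>i. k * c i"]) (simp add: scaleC.sum_right)
    qed
  qed
  thus ?thesis
    using assms(2) that by blast
qed

text \<open>An isometry is injective, so a family and its image satisfy the same linear
  relations.\<close>

lemma cdim_isometric_image:
  fixes U :: "'a::complex_inner \<Rightarrow> 'b::complex_inner"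
  assumes "finite I" and U: "\<And>x y. U (x + y) = U x + U y" "\<And>c x. U (c *\<^sub>C x) = c *\<^sub>C U x"
    and iso: "\<And>x y. cinner (U x) (U y) = cinner x y"
  shows "cdim ((\<lambda>i. U (v i)) ` I) = card I \<longleftrightarrow> cdim (v ` I) = card I"
proof -
  have U0: "U 0 = 0"
    using U(2)[of 0 0] by simp
  have "U (\<Sum>i\<in>I. c i *\<^sub>C v i) = (\<Sum>i\<in>I. c i *\<^sub>C U (v i))" for c
    using \<open>finite I\<close> by induction (simp_all add: U U0)
  moreover have "U x = 0 \<longleftrightarrow> x = 0" for x
    using iso[of x x] by (metis U0 cinner_eq_zero_iff)
  ultimately have "(\<Sum>i\<in>I. c i *\<^sub>C U (v i)) = 0 \<longleftrightarrow> (\<Sum>i\<in>I. c i *\<^sub>C v i) = 0" for c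
    by metis
  thus ?thesis
    by (simp add: independent_family_iff assms(1))
qed

lemma norm_tensor: "norm (\<psi> \<otimes>\<^sub>h \<xi>) = norm \<psi> * norm \<xi>"
proof -
  have "complex_of_real ((norm (\<psi> \<otimes>\<^sub>h \<xi>))\<^sup>2) = of_real ((norm \<psi> * norm \<xi>)\<^sup>2)"
    using cinner_tensor[of \<psi> \<xi> \<psi> \<xi>] by (simp only: cinner_self power_mult_distrib of_real_mult)
  hence "(norm (\<psi> \<otimes>\<^sub>h \<xi>))\<^sup>2 = (norm \<psi> * norm \<xi>)\<^sup>2"
    using of_real_eq_iff by blast
  thus ?thesis
    by simp
qed

text \<open>The setting of the theorem once the defect operator is factored through
  \<open>g\<close>. The vector is a parameter because a model of \<open>T\<close> yields a second
  one, \<open>g'\<close>, to which the same results apply.\<close>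

locale rank_one_defect =
  fixes T :: "'d::finite \<Rightarrow> 'h::chilbert_space \<Rightarrow> 'h" and g :: 'h
  assumes clinear: "bounded_clinear (T i)"
    and defect: "h - (\<Sum>i\<in>UNIV. T i (cadj (T i) h)) = cinner g h *\<^sub>C g"
    and pure: "pure_tuple T"
    and defect_nz: "g \<noteq> 0"
begin

section \<open>The orbit of \<open>g\<close> under words, and the defect spaces it spans\<close>

definition orbit :: "'d list \<Rightarrow> 'h" where
  "orbit w = word_op T w g"

lemma orbit_simps [simp]: "orbit [] = g" "orbit (i # w) = T i (orbit w)"
  by (simp_all add: orbit_def)

text \<open>Passing from \<open>n\<close> to \<open>n + 1\<close> applies \<open>Psi\<close> to the
  previous operator and adds the first defect operator: \<open>Psi\<close> prefixes a letter to each
  word, and the added term belongs to the empty word.\<close>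

lemma defect_op_eq: "defect_op T n h = (\<Sum>w | length w < n. cinner (orbit w) h *\<^sub>C orbit w)"
proof (induction n arbitrary: h)
  case 0
  show ?case by (simp add: defect_op_def)
next
  case (Suc n)
  have "(Psi T ^^ n) id x = x - (\<Sum>w | length w < n. cinner (orbit w) x *\<^sub>C orbit w)" for x
    using Suc[of x] by (simp add: defect_op_def algebra_simps)
  hence "(Psi T ^^ Suc n) id h = (\<Sum>i\<in>UNIV. T i (cadj (T i) h))
      - (\<Sum>i\<in>UNIV. \<Sum>w | length w < n. cinner (orbit (i # w)) h *\<^sub>C orbit (i # w))"
    by (simp add: Psi_def bounded_clinearD[OF clinear] cinner_cadj[OF clinear] sum_subtractf)
  hence "defect_op T (Suc n) h = (h - (\<Sum>i\<in>UNIV. T i (cadj (T i) h)))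
      + (\<Sum>i\<in>UNIV. \<Sum>w | length w < n. cinner (orbit (i # w)) h *\<^sub>C orbit (i # w))"
    by (simp add: defect_op_def)
  thus ?case
    by (simp add: sum_words_less_Suc defect)
qed

lemma defect_space_eq: "defect_space T n = cspan (orbit ` {w. length w < n})"
  unfolding defect_space_def defect_op_eq[abs_def]
  by (rule closure_range_frame_operator) simp

lemma defect_space_1: "defect_space T 1 = cspan {g}"
proof -
  have "{w :: 'd list. length w < 1} = {[]}"
    by auto
  thus ?thesis by (simp add: defect_space_eq del: One_nat_def)
qed

text \<open>Linear independence of the family \<open>orbit\<close> over all words, in the form of
  \<open>independent_family_iff\<close>.\<close>

definition free :: bool where
  "free \<longleftrightarrow> (\<forall>n. cdim (orbit ` {w. length w < n}) = card {w :: 'd list. length w < n})"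

lemma free_iff:
  "free \<longleftrightarrow> (\<forall>n c. (\<Sum>w | length w < n. c w *\<^sub>C orbit w) = 0 \<longrightarrow> (\<forall>w. length w < n \<longrightarrow> c w = 0))"
  by (simp add: free_def independent_family_iff)

text \<open>The words shorter than \<open>n\<close> number \<open>1 + d + ... + d^(n-1)\<close> and
  the first defect index is \<open>1\<close>, so maximality says that the vectors spanning each
  defect space are independent.\<close>

lemma maximal_iff:
  assumes "contractive_tuple T" "cdimension (UNIV :: 'h set) = \<infinity>"
  shows "maximal_tuple T \<longleftrightarrow> free"
proof -
  have idx: "defect_index T n = enat (cdim (orbit ` {w. length w < n}))" for n
    unfolding defect_index_def defect_space_eq by (rule cdimension_cspan) simp
  have "cdim {g} = 1"
    using complex_vector.dim_eq_card_independent[of "{g}"] defect_nz by simp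
  moreover have "orbit ` {w. length w < 1} = {g}"
    by auto
  ultimately have one: "defect_index T 1 = 1"
    unfolding idx by (simp add: one_enat_def del: One_nat_def)
  have "maximal_tuple T \<longleftrightarrow>
      (\<forall>n\<ge>1. cdim (orbit ` {w. length w < n}) = card {w :: 'd list. length w < n})"
    unfolding maximal_tuple_def one using assms
    by (simp add: one idx card_words_less flip: one_enat_def)
  also have "\<dots> \<longleftrightarrow> free"
    unfolding free_def
  proof (intro iffI allI)
    fix n assume "\<forall>n\<ge>1. cdim (orbit ` {w. length w < n}) = card {w :: 'd list. length w < n}"
    \<comment> \<open>Maximality says nothing about \<open>n = 0\<close>, where there are no words
      and both numbers are \<open>0\<close>.\<close>
    moreover have "cdim ({} :: 'h set) = 0"
      using complex_vector.dim_le_card[of "{} :: 'h set" "{}"] by simp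
    ultimately show "cdim (orbit ` {w. length w < n}) = card {w :: 'd list. length w < n}"
      by (cases n) simp_all
  qed simp
  finally show ?thesis .
qed

text \<open>The first defect space is the line of \<open>g\<close>, so \<open>P\<close> vanishes on
  it iff its value at \<open>g\<close>, a linear combination of the orbit with the coefficients of
  \<open>P\<close>, is zero.\<close>

lemma free_iff_polynomial:
  "free \<longleftrightarrow> \<not> (\<exists>P :: 'd list \<Rightarrow>\<^sub>0 complex. P \<noteq> 0 \<and> (\<forall>h\<in>defect_space T 1. nc_eval P T h = 0))"
proof -
  have D1: "(\<forall>h\<in>defect_space T 1. nc_eval P T h = 0) \<longleftrightarrow>
      (\<Sum>w\<in>Poly_Mapping.keys P. Poly_Mapping.lookup P w *\<^sub>C orbit w) = 0" for P :: "'d list \<Rightarrow>\<^sub>0 complex"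
  proof -
    have "nc_eval P T (k *\<^sub>C g)
        = k *\<^sub>C (\<Sum>w\<in>Poly_Mapping.keys P. Poly_Mapping.lookup P w *\<^sub>C orbit w)" for k
      by (simp add: nc_eval_def orbit_def scaleC.sum_right mult.commute
          bounded_clinearD[OF bounded_clinear_word_op[OF clinear]])
    thus ?thesis
      unfolding defect_space_1 complex_vector.span_singleton
      by (auto dest!: spec[of _ 1])
  qed
  have "free \<longleftrightarrow> (\<forall>P :: 'd list \<Rightarrow>\<^sub>0 complex.
      (\<Sum>w\<in>Poly_Mapping.keys P. Poly_Mapping.lookup P w *\<^sub>C orbit w) = 0 \<longrightarrow> P = 0)"
  proof (intro iffI allI impI)
    fix P :: "'d list \<Rightarrow>\<^sub>0 complex"
    assume "free" and P: "(\<Sum>w\<in>Poly_Mapping.keys P. Poly_Mapping.lookup P w *\<^sub>C orbit w) = 0"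
    \<comment> \<open>Exceeds the length of every word in \<open>P\<close>; for \<open>P = 0\<close>
      there is no word to bound.\<close>
    define n where "n = Suc (Max (length ` Poly_Mapping.keys P))"
    have n: "length w < n" if "w \<in> Poly_Mapping.keys P" for w
      unfolding n_def less_Suc_eq_le by (rule Max_ge) (use that in auto)
    have "(\<Sum>w | length w < n. Poly_Mapping.lookup P w *\<^sub>C orbit w)
        = (\<Sum>w\<in>Poly_Mapping.keys P. Poly_Mapping.lookup P w *\<^sub>C orbit w)"
      by (rule sum.mono_neutral_right) (use n in \<open>auto simp: in_keys_iff\<close>)
    with \<open>free\<close> P have "\<forall>w. length w < n \<longrightarrow> Poly_Mapping.lookup P w = 0"
      by (simp add: free_iff)
    with n show "P = 0"
      by (metis in_keys_iff lookup_zero poly_mapping_eqI)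
  next
    assume *: "\<forall>P :: 'd list \<Rightarrow>\<^sub>0 complex.
      (\<Sum>w\<in>Poly_Mapping.keys P. Poly_Mapping.lookup P w *\<^sub>C orbit w) = 0 \<longrightarrow> P = 0"
    show free
      unfolding free_iff
    proof (intro allI impI)
      fix n and w :: "'d list" and c :: "'d list \<Rightarrow> complex"
      assume c: "(\<Sum>w | length w < n. c w *\<^sub>C orbit w) = 0" and w: "length w < n"
      \<comment> \<open>The coefficients are cut off at length \<open>n\<close> to make the support
        finite.\<close>
      define P where "P = Abs_poly_mapping (\<lambda>w. if length w < n then c w else 0)"
      have P: "Poly_Mapping.lookup P u = (if length u < n then c u else 0)" for u
      proof -
        have "finite {u :: 'd list. (if length u < n then c u else 0) \<noteq> 0}"
          by (rule finite_subset[OF _ finite_words_less[of n]]) auto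
        thus ?thesis
          by (simp add: P_def Abs_poly_mapping_inverse)
      qed
      have "(\<Sum>w\<in>Poly_Mapping.keys P. Poly_Mapping.lookup P w *\<^sub>C orbit w)
          = (\<Sum>w | length w < n. Poly_Mapping.lookup P w *\<^sub>C orbit w)"
        by (rule sum.mono_neutral_left) (auto simp: in_keys_iff P split: if_splits)
      also have "\<dots> = 0"
        using c by (simp add: P)
      finally have "P = 0"
        using * by blast
      thus "c w = 0"
        using P[of w] w by simp
    qed
  qed
  thus ?thesis
    unfolding D1 by blast
qed

subsection \<open>The Poisson kernel\<close>

text \<open>Purity makes the defect operators tend strongly to the identity; with
  \<open>defect_op_eq\<close> this is a Parseval identity for the orbit.\<close>

lemma cinner_partial_tendsto:
  "(\<lambda>n. \<Sum>w | length w < n. cinner h (orbit w) * cinner (orbit w) k) \<longlonglongrightarrow> cinner h k"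
proof -
  have "(\<lambda>n. cinner h (k - (Psi T ^^ n) id k)) \<longlonglongrightarrow> cinner h (k - 0)"
    using pure unfolding pure_tuple_def by (intro cinner.tendsto tendsto_intros) auto
  moreover have "cinner h (k - (Psi T ^^ n) id k)
      = (\<Sum>w | length w < n. cinner h (orbit w) * cinner (orbit w) k)" for n
  proof -
    have "cinner h (k - (Psi T ^^ n) id k) = cinner h (defect_op T n k)"
      by (simp add: defect_op_def)
    thus ?thesis
      by (simp add: defect_op_eq cinner.sum_right cinner_scaleC_right mult.commute)
  qed
  ultimately show ?thesis by simp
qed

text \<open>For \<open>h = k\<close> the partial sums by length increase to the squared norm of
  \<open>h\<close>, and every finite set of words lies in one of bounded length.\<close>

lemma square_summable: "(\<lambda>w. (cmod (cinner (orbit w) h))\<^sup>2) summable_on UNIV"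
proof (rule nonneg_bdd_above_summable_on)
  have *: "(\<lambda>n. \<Sum>w | length w < n. (cmod (cinner (orbit w) h))\<^sup>2) \<longlonglongrightarrow> (norm h)\<^sup>2"
  proof -
    have "cinner h (orbit w) * cinner (orbit w) h = of_real ((cmod (cinner (orbit w) h))\<^sup>2)" for w
      using complex_norm_square[of "cinner (orbit w) h"]
      by (simp add: cinner_commute[of h "orbit w"] mult.commute)
    hence "(\<lambda>n. complex_of_real (\<Sum>w | length w < n. (cmod (cinner (orbit w) h))\<^sup>2))
        \<longlonglongrightarrow> of_real ((norm h)\<^sup>2)"
      using cinner_partial_tendsto[of h h] by (simp add: cinner_self)
    thus ?thesis
      using tendsto_of_real_iff by blast
  qed
  have "incseq (\<lambda>n. \<Sum>w | length w < n. (cmod (cinner (orbit w) h))\<^sup>2)"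
    by (intro monoI sum_mono2) auto
  note le = incseq_le[OF this *]
  show "bdd_above (sum (\<lambda>w. (cmod (cinner (orbit w) h))\<^sup>2) ` {F. F \<subseteq> UNIV \<and> finite F})"
  proof (rule bdd_aboveI2)
    fix F :: "'d list set" assume F: "F \<in> {F. F \<subseteq> UNIV \<and> finite F}"
    have "F \<subseteq> {w. length w < Suc (Max (length ` F))}"
      using F by (auto simp: less_Suc_eq_le)
    hence "sum (\<lambda>w. (cmod (cinner (orbit w) h))\<^sup>2) F
        \<le> (\<Sum>w | length w < Suc (Max (length ` F)). (cmod (cinner (orbit w) h))\<^sup>2)"
      by (intro sum_mono2) auto
    also have "\<dots> \<le> (norm h)\<^sup>2"
      by (rule le)
    finally show "sum (\<lambda>w. (cmod (cinner (orbit w) h))\<^sup>2) F \<le> (norm h)\<^sup>2" .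
  qed
qed simp

text \<open>The Poisson kernel with the first defect space identified with the scalars through the
  unit vector along \<open>g\<close>; see \<open>poisson_kernel_eq\<close>.\<close>

definition embed :: "'h \<Rightarrow> 'd fock" where
  "embed h = Abs_ell2 (\<lambda>w. cinner (orbit w) h)"

lemma ell2_nth_embed: "ell2_nth (embed h) w = cinner (orbit w) h"
  by (simp add: embed_def Abs_ell2_inverse square_summable)

lemma embed_add: "embed (x + y) = embed x + embed y"
  by (rule ell2_eqI) (simp add: ell2_nth_embed plus_ell2.rep_eq cinner_add_right)

lemma embed_scaleC: "embed (c *\<^sub>C x) = c *\<^sub>C embed x"
  by (rule ell2_eqI) (simp add: ell2_nth_embed scaleC_ell2.rep_eq cinner_scaleC_right scaleC_complex_def)

text \<open>Both sides are the limit of the same partial sums by word length.\<close>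

lemma cinner_embed: "cinner (embed h) (embed k) = cinner h k"
proof (rule LIMSEQ_unique)
  have "((\<lambda>w. cinner (ell2_nth (embed h) w) (ell2_nth (embed k) w)) has_sum cinner (embed h) (embed k)) UNIV"
    unfolding cinner_ell2_def by (rule has_sum_infsum[OF cinner_ell2_summable])
  hence "((\<lambda>w. cinner h (orbit w) * cinner (orbit w) k) has_sum cinner (embed h) (embed k)) UNIV"
    by (simp add: ell2_nth_embed cinner_complex_def flip: cinner_commute)
  thus "(\<lambda>n. \<Sum>w | length w < n. cinner h (orbit w) * cinner (orbit w) k) \<longlonglongrightarrow> cinner (embed h) (embed k)"
    unfolding has_sum_def by (rule filterlim_compose[OF _ filterlim_words_less])
qed (rule cinner_partial_tendsto)

lemma norm_embed: "norm (embed h) = norm h"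
  by (simp add: norm_eq_sqrt_inner inner_eq_Re_cinner cinner_embed)

lemma bounded_linear_embed: "bounded_linear embed"
proof (rule bounded_linear_intro)
  show "norm (embed x) \<le> norm x * 1" for x
    by (simp add: norm_embed)
qed (simp_all add: embed_add embed_scaleC scaleR_scaleC)

text \<open>The intertwining relation of the Poisson kernel: at \<open>w\<close> both sides have the
  coordinate \<open>cinner (orbit (i # w)) h\<close>.\<close>

lemma embed_cadj: "embed (cadj (T i) h) = annihilation i (embed h)"
  by (rule ell2_eqI) (simp add: ell2_nth_embed annihilation.rep_eq cinner_cadj[OF clinear])

lemma poisson_kernel_eq: "poisson_kernel T h = (1 / of_real (norm g)) *\<^sub>C (embed h \<otimes>\<^sub>h g)"
proof -
  have "defect_sqrt T = (\<lambda>x. (cinner g x / of_real (norm g)) *\<^sub>C g)"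
    unfolding defect_sqrt_def defect by (rule sqrt_op_rank_one[OF defect_nz])
  hence "defect_sqrt T (cadj (word_op T w) h)
      = ell2_nth ((1 / of_real (norm g)) *\<^sub>C (embed h \<otimes>\<^sub>h g)) w" for w
    by (simp add: cinner_cadj[OF bounded_clinear_word_op[OF clinear]] scaleC_ell2.rep_eq
        tensor.rep_eq ell2_nth_embed orbit_def)
  thus ?thesis
    unfolding poisson_kernel_def by (simp add: infsumI[OF has_sum_ell2])
qed

text \<open>Tested against \<open>h\<close>, the adjoint meets the coordinates of
  \<open>embed h\<close>, which are inner products with the orbit. The factor \<open>norm g\<close>
  is \<open>cinner g g\<close> divided by the \<open>norm g\<close> in
  \<open>poisson_kernel_eq\<close>.\<close>

lemma cadj_poisson_kernel:
  "cadj (poisson_kernel T) ((\<Sum>w | length w < n. c w *\<^sub>C basis_vec w) \<otimes>\<^sub>h g)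
    = of_real (norm g) *\<^sub>C (\<Sum>w | length w < n. c w *\<^sub>C orbit w)"
proof (rule cinner_ext)
  fix h
  have "bounded_linear (\<lambda>h. embed h \<otimes>\<^sub>h g)"
  proof (rule bounded_linear_intro)
    show "norm (embed x \<otimes>\<^sub>h g) \<le> norm x * norm g" for x
      by (simp add: norm_tensor norm_embed)
  qed (simp_all add: embed_add embed_scaleC scaleR_scaleC tensor_add_left tensor_scaleC_left)
  hence "bounded_clinear (poisson_kernel T)"
    unfolding poisson_kernel_eq[abs_def] bounded_clinear_def
    by (auto simp: embed_scaleC tensor_scaleC_left mult.commute
        intro: bounded_linear_compose[OF scaleC.bounded_linear_right])
  hence "cinner h (cadj (poisson_kernel T) ((\<Sum>w | length w < n. c w *\<^sub>C basis_vec w) \<otimes>\<^sub>h g))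
      = cinner (poisson_kernel T h) ((\<Sum>w | length w < n. c w *\<^sub>C basis_vec w) \<otimes>\<^sub>h g)"
    by (rule cinner_cadj)
  also have "\<dots> = of_real (norm g) * cinner (embed h) (\<Sum>w | length w < n. c w *\<^sub>C basis_vec w)"
    using defect_nz
    by (simp add: poisson_kernel_eq cinner_scaleC_left cinner_tensor cinner_self power2_eq_square)
  also have "\<dots> = cinner h (of_real (norm g) *\<^sub>C (\<Sum>w | length w < n. c w *\<^sub>C orbit w))"
    by (simp add: cinner.sum_right cinner_scaleC_right cinner_basis_vec_right ell2_nth_embed
        flip: cinner_commute)
  finally show "cinner h (cadj (poisson_kernel T) ((\<Sum>w | length w < n. c w *\<^sub>C basis_vec w) \<otimes>\<^sub>h g))
      = cinner h (of_real (norm g) *\<^sub>C (\<Sum>w | length w < n. c w *\<^sub>C orbit w))" .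
qed

text \<open>As the first defect space is the line of \<open>g\<close>, elementary tensors already
  have this form; they span a finite-dimensional, hence closed, space, so the closure adds
  nothing.\<close>

lemma tensor_space_fock_upto:
  fixes \<phi> :: "('d list, 'h) ell2"
  assumes "\<phi> \<in> tensor_space (fock_upto n) (defect_space T 1)"
  obtains c where "\<phi> = (\<Sum>w | length w < Suc n. c w *\<^sub>C basis_vec w) \<otimes>\<^sub>h g"
proof -
  let ?I = "{w :: 'd list. length w < Suc n}"
  let ?M = "cspan ((\<lambda>w. basis_vec w \<otimes>\<^sub>h g) ` ?I)"
  have im: "(\<lambda>\<psi>. \<psi> \<otimes>\<^sub>h g) ` cspan S = cspan ((\<lambda>\<psi>. \<psi> \<otimes>\<^sub>h g) ` S)" for S :: "'d fock set"
    by (rule cspan_image) (simp_all add: tensor_add_left tensor_scaleC_left)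
  have M: "?M = (\<lambda>\<psi>. \<psi> \<otimes>\<^sub>h g) ` fock_upto n"
    unfolding fock_upto_eq im image_image ..
  have "{\<psi> \<otimes>\<^sub>h \<xi> | \<psi> \<xi>. \<psi> \<in> fock_upto n \<and> \<xi> \<in> defect_space T 1} \<subseteq> ?M"
    unfolding defect_space_1 complex_vector.span_singleton
  proof clarify
    fix \<psi> :: "'d fock" and k assume "\<psi> \<in> fock_upto n"
    hence "\<psi> \<otimes>\<^sub>h g \<in> ?M"
      unfolding M by blast
    thus "\<psi> \<otimes>\<^sub>h (k *\<^sub>C g) \<in> ?M"
      unfolding tensor_scaleC_right by (rule complex_vector.span_scale)
  qed
  hence "tensor_space (fock_upto n) (defect_space T 1) \<subseteq> ?M"
    unfolding tensor_space_def using closed_cspan_finite[of "(\<lambda>w. basis_vec w \<otimes>\<^sub>h g) ` ?I"]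
    by (intro closure_minimal complex_vector.span_minimal) (auto simp: closed_csubspace_def)
  from subsetD[OF this assms] obtain \<psi> where \<psi>: "\<phi> = \<psi> \<otimes>\<^sub>h g" "\<psi> \<in> fock_upto n"
    unfolding M by (rule imageE)
  obtain c where "\<psi> = (\<Sum>w\<in>?I. c w *\<^sub>C basis_vec w)"
    by (rule cspan_imageE[OF finite_words_less \<psi>(2)[unfolded fock_upto_eq]])
  with \<psi>(1) show ?thesis
    using that by blast
qed

text \<open>By the two preceding results, elements of the intersection correspond to linear
  relations among orbit vectors of words of length at most \<open>n\<close>.\<close>

lemma free_iff_poisson_kernel:
  "free \<longleftrightarrow>
    (\<forall>n\<ge>1. tensor_space (fock_upto n) (defect_space T 1) \<inter> poisson_adj_kernel T = {0})"
proof (intro iffI allI impI)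
  fix n :: nat
  assume free
  let ?X = "tensor_space (fock_upto n) (defect_space T 1) \<inter> poisson_adj_kernel T"
  have "\<phi> = 0" if \<phi>: "\<phi> \<in> ?X" for \<phi> :: "('d list, 'h) ell2"
  proof -
    obtain c where c: "\<phi> = (\<Sum>w | length w < Suc n. c w *\<^sub>C basis_vec w) \<otimes>\<^sub>h g"
      by (rule tensor_space_fock_upto[OF IntD1[OF \<phi>]])
    have "cadj (poisson_kernel T) \<phi> = 0"
      using \<phi> by (simp add: poisson_adj_kernel_def)
    hence "(\<Sum>w | length w < Suc n. c w *\<^sub>C orbit w) = 0"
      using defect_nz unfolding c cadj_poisson_kernel by simp
    hence "\<forall>w. length w < Suc n \<longrightarrow> c w = 0"
      using \<open>free\<close> unfolding free_iff by blast
    hence "(\<Sum>w | length w < Suc n. c w *\<^sub>C basis_vec w) = 0"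
      by (intro sum.neutral) simp
    thus "\<phi> = 0"
      using tensor_scaleC_left[of 0 0 g] by (simp add: c)
  qed
  moreover have "0 \<in> ?X"
  proof -
    \<comment> \<open>At \<open>n = 0\<close> the sums are empty, which gives the value at
      zero.\<close>
    have "cadj (poisson_kernel T) (0 \<otimes>\<^sub>h g) = 0"
      using cadj_poisson_kernel[where n = 0] by simp
    moreover have "0 \<otimes>\<^sub>h g = (0 :: ('d list, 'h) ell2)"
      using tensor_scaleC_left[of 0 0 g] by simp
    moreover have "0 \<in> tensor_space M N" for M :: "'d fock set" and N :: "'h set"
      unfolding tensor_space_def using closure_subset complex_vector.span_zero by blast
    ultimately show ?thesis
      by (simp add: poisson_adj_kernel_def)
  qed
  ultimately show "?X = {0}"
    by blast
next
  assume *: "\<forall>n\<ge>1. tensor_space (fock_upto n) (defect_space T 1) \<inter> poisson_adj_kernel T = {0}"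
  show free
    unfolding free_iff
  proof (intro allI impI)
    fix n and w :: "'d list" and c :: "'d list \<Rightarrow> complex"
    assume c: "(\<Sum>w | length w < n. c w *\<^sub>C orbit w) = 0" and w: "length w < n"
    define \<psi> where "\<psi> = (\<Sum>w | length w < n. c w *\<^sub>C basis_vec w)"
    have "\<psi> \<in> fock_upto n"
      unfolding \<psi>_def fock_upto_eq
      by (intro complex_vector.span_sum complex_vector.span_scale complex_vector.span_base) auto
    moreover have "g \<in> defect_space T 1"
      unfolding defect_space_1 by (simp add: complex_vector.span_base)
    ultimately have "\<psi> \<otimes>\<^sub>h g \<in> tensor_space (fock_upto n) (defect_space T 1)"
      "\<psi> \<otimes>\<^sub>h g \<in> tensor_space UNIV (defect_space T 1)"
      unfolding tensor_space_def
      by (intro subsetD[OF closure_subset] complex_vector.span_base; blast)+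
    moreover have "cadj (poisson_kernel T) (\<psi> \<otimes>\<^sub>h g) = 0"
      unfolding \<psi>_def cadj_poisson_kernel c by simp
    ultimately have "\<psi> \<otimes>\<^sub>h g \<in> tensor_space (fock_upto n) (defect_space T 1) \<inter> poisson_adj_kernel T"
      by (simp add: poisson_adj_kernel_def)
    \<comment> \<open>The hypothesis covers only \<open>n \<ge> 1\<close>; the existence of
      \<open>w\<close> excludes \<open>n = 0\<close>.\<close>
    with * w have "\<psi> \<otimes>\<^sub>h g = 0"
      by (cases n) auto
    hence "ell2_nth \<psi> w *\<^sub>C g = 0"
      by (metis tensor.rep_eq zero_ell2.rep_eq)
    hence "ell2_nth \<psi> w = 0"
      using defect_nz by simp
    moreover have "ell2_nth \<psi> w = (\<Sum>u | length u < n. if w = u then c w else 0)"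
      unfolding \<psi>_def ell2_nth_sum
      by (intro sum.cong) (auto simp: scaleC_ell2.rep_eq basis_vec.rep_eq scaleC_complex_def)
    ultimately show "c w = 0"
      using w by simp
  qed
qed

subsection \<open>Compressions of the creation tuple\<close>

text \<open>The model space is the range of the isometry \<open>embed\<close>. Projecting onto it
  amounts to applying the adjoint of \<open>embed\<close> and then \<open>embed\<close>, which sends
  \<open>basis_vec w\<close> to \<open>embed (orbit w)\<close>.\<close>

lemma free_imp_model:
  assumes free
  shows "\<exists>Q :: 'd fock set. coinvariant creation Q \<and>
    (\<forall>n\<ge>1. cdimension (projection Q ` fock_upto n) = enat (\<Sum>k\<le>n. CARD('d) ^ k)) \<and>
    unitarily_equivalent UNIV T Q (\<lambda>i \<psi>. projection Q (creation i \<psi>))"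
proof (intro exI conjI allI impI)
  let ?Q = "range embed"
  have sub: "csubspace ?Q"
    unfolding complex_vector.subspace_def
  proof (intro conjI ballI allI)
    show "0 \<in> ?Q"
      using embed_scaleC[of 0 0] by (intro range_eqI[of _ _ 0]) simp
  qed (auto simp flip: embed_add embed_scaleC)
  have "complete (embed ` UNIV)"
  proof (rule complete_isometric_image[of 1])
    show "\<forall>x\<in>UNIV. 1 * norm x \<le> norm (embed x)"
      by (simp add: norm_embed)
  qed (simp_all add: bounded_linear_embed complete_UNIV)
  hence cl: "closed_csubspace ?Q"
    using sub by (simp add: closed_csubspace_def complete_imp_closed)
  \<comment> \<open>Moved across the inner product, \<open>creation i\<close> becomes
    \<open>annihilation i\<close>, which by \<open>embed_cadj\<close> maps the range of
    \<open>embed\<close> into itself.\<close>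
  have "creation i x \<in> corthogonal ?Q" if "x \<in> corthogonal ?Q" for i x
    using that by (auto simp: corthogonal_def simp flip: cinner_annihilation embed_cadj)
  with cl show "coinvariant creation ?Q"
    by (auto simp: coinvariant_def)
  \<comment> \<open>The condition says that \<open>x\<close> is the adjoint of \<open>embed\<close>
    applied to \<open>\<psi>\<close>.\<close>
  have projection_embed: "projection ?Q \<psi> = embed x" if "\<And>k. cinner (embed k) \<psi> = cinner k x" for \<psi> x
    by (rule projection_eqI[OF sub]) (use that in \<open>auto simp: corthogonal_def cinner.diff_right cinner_embed\<close>)
  have basis: "projection ?Q (basis_vec w) = embed (orbit w)" for w
    by (rule projection_embed) (simp add: cinner_basis_vec_right ell2_nth_embed flip: cinner_commute)
  show "unitarily_equivalent UNIV T ?Q (\<lambda>i \<psi>. projection ?Q (creation i \<psi>))"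
    unfolding unitarily_equivalent_def
  proof (intro exI[of _ embed] conjI ballI allI)
    fix i x
    show "embed (T i x) = projection ?Q (creation i (embed x))"
      by (rule projection_embed[symmetric])
        (simp add: cinner_embed cinner_cadj_left[OF clinear] flip: cinner_annihilation embed_cadj)
  qed (simp_all add: embed_add embed_scaleC cinner_embed)
  fix n :: nat
  let ?I = "{w :: 'd list. length w < Suc n}"
  have "projection ?Q ` fock_upto n = cspan ((\<lambda>w. embed (orbit w)) ` ?I)"
    unfolding fock_upto_eq
    by (subst cspan_image) (simp_all add: projection_add projection_scaleC cl image_image basis)
  moreover have "cdim ((\<lambda>w. embed (orbit w)) ` ?I) = card ?I"
    using assms unfolding free_def
    by (subst cdim_isometric_image) (simp_all add: embed_add embed_scaleC cinner_embed)
  ultimately show "cdimension (projection ?Q ` fock_upto n) = enat (\<Sum>k\<le>n. CARD('d) ^ k)"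
    by (simp add: cdimension_cspan card_words_less lessThan_Suc_atMost)
qed

end

text \<open>
  The vector that \<open>U\<close> maps to the projected vacuum again represents the defect operator of \<open>T\<close>,
  and \<open>U\<close> carries its orbit to the projections of the basis vectors.
\<close>

lemma model_imp_maximal:
  fixes T :: "'d::finite \<Rightarrow> 'h::chilbert_space \<Rightarrow> 'h" and Q :: "'d fock set"
  assumes "rank_one_defect T g"
    and T: "contractive_tuple T" "cdimension (UNIV :: 'h set) = \<infinity>"
    and Q: "coinvariant creation Q"
    and dim: "\<And>n. n \<ge> 1 \<Longrightarrow>
      cdimension (projection Q ` fock_upto n) = enat (\<Sum>k\<le>n. CARD('d) ^ k)"
    and "unitarily_equivalent UNIV T Q (\<lambda>i \<psi>. projection Q (creation i \<psi>))"
  shows "maximal_tuple T"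
proof -
  interpret g: rank_one_defect T g
    by fact
  have cl: "closed_csubspace Q" and inv: "\<And>i x. x \<in> corthogonal Q \<Longrightarrow> creation i x \<in> corthogonal Q"
    using Q by (auto simp: coinvariant_def)
  have sub: "csubspace Q"
    using cl by (simp add: closed_csubspace_def)
  obtain U where U: "\<And>x y. U (x + y) = U x + U y" "\<And>c x. U (c *\<^sub>C x) = c *\<^sub>C U x"
    "\<And>x y. cinner (U x) (U y) = cinner x y" "range U = Q"
    "\<And>i x. U (T i x) = projection Q (creation i (U x))"
    using assms(6) unfolding unitarily_equivalent_def by auto
  have UQ: "U x \<in> Q" for x
    using U(4) by blast
  have eqQ: "x = y" if "x \<in> Q" "y \<in> Q" "\<And>k. cinner (U k) x = cinner (U k) y" for x y
  proof -
    have "x - y \<in> corthogonal Q"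
      using that(3) by (auto simp: corthogonal_def cinner.diff_right simp flip: U(4))
    thus ?thesis
      using corthogonal_Int[of "x - y" Q] complex_vector.subspace_diff[OF sub that(1,2)] by simp
  qed
  obtain g' where g': "U g' = projection Q (basis_vec [])"
    using projection_in[OF cl] U(4) by (metis rangeE)
  \<comment> \<open>Co-invariance makes \<open>Q\<close> invariant under
    \<open>annihilation i\<close>, so the adjoint of the compressed creation operator is the
    restriction of \<open>annihilation i\<close> to \<open>Q\<close>.\<close>
  have adj: "U (cadj (T i) x) = annihilation i (U x)" for i x
  proof (rule eqQ[OF UQ])
    show "annihilation i (U x) \<in> Q"
    proof (rule double_corthogonal[OF cl])
      fix y assume "y \<in> corthogonal Q"
      hence "cinner (U x) (creation i y) = 0"
        using inv[of y i] UQ[of x] by (auto simp: corthogonal_def)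
      thus "cinner y (annihilation i (U x)) = 0"
        by (subst cinner_commute) (simp add: cinner_annihilation)
    qed
    fix k
    have "cinner (annihilation i (U x)) (U k) = cinner (U x) (U (T i k))"
      by (simp add: cinner_annihilation U(5) cinner_projection[OF cl UQ])
    also have "\<dots> = cinner (cadj (T i) x) k"
      by (simp add: U(3) cinner_cadj_left[OF g.clinear])
    finally show "cinner (U k) (U (cadj (T i) x)) = cinner (U k) (annihilation i (U x))"
      by (metis U(3) cinner_commute)
  qed
  \<comment> \<open>Transported by \<open>U\<close>, the defect form is what
    \<open>cinner_fock_split\<close> leaves over: a product of vacuum coordinates, and the one of
    \<open>U x\<close> is \<open>cinner g' x\<close>.\<close>
  have defect': "h - (\<Sum>i\<in>UNIV. T i (cadj (T i) h)) = cinner g' h *\<^sub>C g'" for h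
  proof (rule cinner_ext)
    fix k
    have vac: "ell2_nth (U x) [] = cinner g' x" for x
    proof -
      have "cinner g' x = cinner (projection Q (basis_vec [])) (U x)"
        by (simp flip: g' U(3))
      also have "\<dots> = cinner (basis_vec []) (U x)"
        using cinner_projection[OF cl UQ[of x], of "basis_vec []"] by (metis cinner_commute)
      finally show ?thesis
        by (simp add: cinner_basis_vec)
    qed
    have "cinner k (h - (\<Sum>i\<in>UNIV. T i (cadj (T i) h)))
        = cinner k h - (\<Sum>i\<in>UNIV. cinner (cadj (T i) k) (cadj (T i) h))"
      by (simp add: cinner.diff_right cinner.sum_right cinner_cadj_left[OF g.clinear])
    also have "\<dots> = cinner (U k) (U h)
        - (\<Sum>i\<in>UNIV. cinner (annihilation i (U k)) (annihilation i (U h)))"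
      by (simp add: U(3) flip: adj)
    also have "\<dots> = cnj (cinner g' k) * cinner g' h"
      by (subst cinner_fock_split) (simp add: vac)
    finally show "cinner k (h - (\<Sum>i\<in>UNIV. T i (cadj (T i) h))) = cinner k (cinner g' h *\<^sub>C g')"
      by (simp add: cinner_scaleC_right flip: cinner_commute)
  qed
  \<comment> \<open>Both vectors represent the same defect operator, which is nonzero at
    \<open>g\<close>.\<close>
  have "g' \<noteq> 0"
  proof
    assume "g' = 0"
    hence "cinner g g *\<^sub>C g = 0"
      using g.defect[of g] defect'[of g] by simp
    thus False
      using g.defect_nz by simp
  qed
  then interpret g': rank_one_defect T g'
    using defect' g.clinear g.pure by unfold_locales
  have U_orbit: "U (g'.orbit w) = projection Q (basis_vec w)" for w
  proof (induction w)
    case (Cons i w)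
    let ?p = "projection Q (basis_vec w)"
    \<comment> \<open>By co-invariance, \<open>creation i\<close> keeps the part of
      \<open>basis_vec w\<close> orthogonal to \<open>Q\<close> in the complement, so projecting
      before creating does not change the final projection.\<close>
    have "projection Q (creation i (basis_vec w - ?p)) = 0"
      by (rule projection_eqI[OF sub])
        (auto intro!: inv diff_projection cl complex_vector.subspace_0[OF sub])
    hence "projection Q (creation i (basis_vec w - ?p) + creation i ?p) = projection Q (creation i ?p)"
      by (simp add: projection_add cl)
    thus ?case
      by (simp add: U(5) Cons creation_diff creation_basis_vec)
  qed (simp add: g')
  have "cdim (g'.orbit ` {w. length w < Suc n}) = card {w :: 'd list. length w < Suc n}" if "n \<ge> 1" for n
  proof -
    let ?I = "{w :: 'd list. length w < Suc n}"
    have "projection Q ` fock_upto n = cspan ((\<lambda>w. U (g'.orbit w)) ` ?I)"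
      unfolding fock_upto_eq
      by (subst cspan_image) (simp_all add: projection_add projection_scaleC cl image_image U_orbit)
    hence "cdim ((\<lambda>w. U (g'.orbit w)) ` ?I) = card ?I"
      using dim[OF that] by (simp add: cdimension_cspan card_words_less lessThan_Suc_atMost)
    thus ?thesis
      by (simp add: cdim_isometric_image U)
  qed
  hence c0: "(\<Sum>w | length w < Suc n. c w *\<^sub>C g'.orbit w) = 0 \<Longrightarrow> length w < Suc n \<Longrightarrow> c w = 0"
    if "n \<ge> 1" for n c w
    using that by (auto simp: independent_family_iff)
  have "g'.free"
    unfolding g'.free_iff
  proof (intro allI impI)
    fix n and w :: "'d list" and c :: "'d list \<Rightarrow> complex"
    assume c: "(\<Sum>w | length w < n. c w *\<^sub>C g'.orbit w) = 0" and w: "length w < n"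
    \<comment> \<open>Independence is known for the bounds \<open>Suc n\<close> with
      \<open>n \<ge> 1\<close>: extending \<open>c\<close> by zero at length \<open>n\<close>
      reaches them, and \<open>w\<close> forces \<open>n \<ge> 1\<close>.\<close>
    let ?c = "\<lambda>w. if length w < n then c w else 0"
    have "(\<Sum>w | length w < Suc n. ?c w *\<^sub>C g'.orbit w) = (\<Sum>w | length w < n. ?c w *\<^sub>C g'.orbit w)"
      by (rule sum.mono_neutral_right) auto
    also have "\<dots> = 0"
      using c by simp
    finally have "?c w = 0"
      using w by (intro c0[of n ?c w]) auto
    thus "c w = 0"
      using w by simp
  qed
  thus ?thesis
    using g'.maximal_iff[OF T] by simp
qed

section \<open>Equivalence of the four conditions for pure tuples of defect index one\<close>

theorem theorem3p9:
  fixes T :: "'d::finite \<Rightarrow> 'h::chilbert_space \<Rightarrow> 'h"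
  assumes "contractive_tuple T"
    and "pure_tuple T"
    and "cdimension (UNIV :: 'h set) = \<infinity>"
    and "defect_index T 1 = 1"
  shows
    "(maximal_tuple T \<longleftrightarrow>
        \<not> (\<exists>P :: 'd list \<Rightarrow>\<^sub>0 complex. P \<noteq> 0 \<and> (\<forall>h\<in>defect_space T 1. nc_eval P T h = 0)))
     \<and> (maximal_tuple T \<longleftrightarrow>
        (\<exists>Q :: 'd fock set. coinvariant creation Q \<and>
           (\<forall>n\<ge>1. cdimension (projection Q ` fock_upto n) = enat (\<Sum>k\<le>n. CARD('d) ^ k)) \<and>
           unitarily_equivalent UNIV T Q (\<lambda>i \<psi>. projection Q (creation i \<psi>))))
     \<and> (maximal_tuple T \<longleftrightarrow>
        (\<forall>n\<ge>1. tensor_space (fock_upto n) (defect_space T 1) \<inter> poisson_adj_kernel T = {0}))"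
proof -
  have cl: "\<And>i. bounded_clinear (T i)"
    and pos: "positive_op (\<lambda>h. h - (\<Sum>i\<in>UNIV. T i (cadj (T i) h)))"
    using assms(1) by (auto simp: contractive_tuple_def)
  have "defect_op T 1 = (\<lambda>h. h - (\<Sum>i\<in>UNIV. T i (cadj (T i) h)))"
    by (simp add: defect_op_def Psi_def)
  hence "cdimension (closure (range (\<lambda>h. h - (\<Sum>i\<in>UNIV. T i (cadj (T i) h))))) = 1"
    using assms(4) by (simp add: defect_index_def defect_space_def)
  from positive_rank_one[OF pos this] obtain g
    where g: "g \<noteq> 0" "\<And>h. h - (\<Sum>i\<in>UNIV. T i (cadj (T i) h)) = cinner g h *\<^sub>C g"
    by blast
  interpret rank_one_defect T g
    using cl g assms(2) by unfold_locales
  note max = maximal_iff[OF assms(1,3)]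
  have model: "maximal_tuple T \<longleftrightarrow>
      (\<exists>Q :: 'd fock set. coinvariant creation Q \<and>
         (\<forall>n\<ge>1. cdimension (projection Q ` fock_upto n) = enat (\<Sum>k\<le>n. CARD('d) ^ k)) \<and>
         unitarily_equivalent UNIV T Q (\<lambda>i \<psi>. projection Q (creation i \<psi>)))"
    using free_imp_model model_imp_maximal[OF rank_one_defect_axioms assms(1,3)] max by blast
  show ?thesis
    by (intro conjI trans[OF max free_iff_polynomial] model trans[OF max free_iff_poisson_kernel])
qed

end
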